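(* Let $G=G(\mathcal V,\mathcal E)$ be a finite strongly connected directed graph, not a cycle, such that $G(\mathcal V,\mathcal F_G)$ is a tree of uniform height two. Suppose that each of the three numbers $I^{(e)}_5$, $I^{(e)}_9$ and $I^{(e)}_{10}$ has the same value for all $e\in\mathcal E\setminus\mathcal F_G$. Then $G$ is spherically homogeneous.
   Context: Graphs are finite directed graphs $G=G(\mathcal V,\mathcal E)$ (loops and multiple edges allowed) with source map $s$ and target map $t$. $\mathbb N=\{1,2,\dots\}$. Graph inverse semigroup $\mathcal S(G)$: the semigroup with zero generated by $\mathbf 1_V$ ($V\in\mathcal V$), $e^-,e^+$ ($e\in\mathcal E$), with relations $\mathbf 1_V^2=\mathbf 1_V$, $\mathbf 1_U\mathbf 1_W=0$ for $U\ne W$, $f^-f^+=\mathbf 1_{s(f)}$, $f^-g^+=0$ for $f\neq g$, $\mathbf 1_{s(f)}f^-=f^-=f^-\mathbf 1_{t(f)}$, $\mathbf 1_{t(f)}f^+=f^+=f^+\mathbf 1_{s(f)}$. For the graph with one vertex and $N>1$ loops this is the Dyck inverse monoid $\mathcal D_N$. Markov-Dyck shift $MD(G)$: the subshift with alphabet $\{e^-,e^+:e\in\mathcal E\}$ in which a word is admissible precisely if its product in $\mathcal S(G)$ is not $0$. $\mathcal F_G$ is the set of edges that are the only incoming edge of their target vertex. Suppose $G(\mathcal V,\mathcal F_G)$ is a directed tree (the subtree of $G$), with root $V(0)$; then every $e\in\mathcal E\setminus\mathcal F_G$ has target $V(0)$. The level of a vertex is its distance from $V(0)$ in this tree. The tree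 is said to have uniform height (or depth) two if all of its leaves are at level two and the source vertices of all edges $e\in\mathcal E\setminus\mathcal F_G$ are at level two. $G$ is spherically homogeneous if all leaves of the subtree are at the same level, all vertices of the subtree at the same level have the same out-degree in the subtree, all source vertices of edges in $\mathcal E\setminus\mathcal F_G$ are leaves of the subtree, and all leaves have the same out-degree in $G$. Let $\nu=\operatorname{card}(\mathcal E\setminus\mathcal F_G)$ and let $\mathcal D_\nu$ be the Dyck inverse monoid of the one-vertex graph with loops $\widehat e$, $e\in\mathcal E\setminus\mathcal F_G$. Put $\widehat{e^\pm}=\widehat e^{\,\pm}$ if $e\in\mathcal E\setminus\mathcal F_G$, and $\widehat{f^{\pm}}=\mathbf 1$ if $f\in\mathcal F_G$. For $e\in\mathcal E\setminus\mathcal F_G$, a periodic point $p$ of $MD(G)$ of least period $k$ (and its orbit, of length $k$) has negative multiplier $\widehat e$ if $\prod_{i\le j<i+k}\widehat{p_j}=(\widehat e^{\,-})^M$ for some $i\in\mathbb Z$ and $M\in\mathbb N$. $I^{(e)}_k$ is the number of periodic orbits of length $k$ of $MD(G)$ with negative multiplier $\widehat e$. *)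

theory Defs
  imports
    "Graph_Theory.Digraph_Component"
    "HOL-Combinatorics.Orbits"
begin

text \<open>
  Directed multigraphs are the library's \<open>pre_digraph\<close> records: the source map is \<open>tail\<close>,
  the target map is \<open>head\<close>.
\<close>


section \<open>Graph inverse semigroups\<close>

datatype 'e symbol = Neg 'e | Pos 'e

datatype ('v, 'e) generator = Zero | Idem 'v | Sym "'e symbol"

definition symbols :: "('v, 'e) pre_digraph \<Rightarrow> 'e symbol set" where
  "symbols G = Neg ` arcs G \<union> Pos ` arcs G"

definition generators :: "('v, 'e) pre_digraph \<Rightarrow> ('v, 'e) generator set" where
  "generators G = insert Zero (Idem ` verts G \<union> Sym ` symbols G)"

text \<open>
  The semigroup with zero is given by a presentation: \<open>gis_cong G\<close> is the congruence on the free
  semigroup of nonempty words over the generators that is generated by the defining relations.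
  The zero is an additional generator, made absorbing by \<open>zero_left\<close> and \<open>zero_right\<close>.
\<close>

inductive gis_cong ::
  "('v, 'e) pre_digraph \<Rightarrow> ('v, 'e) generator list \<Rightarrow> ('v, 'e) generator list \<Rightarrow> bool"
  for G where
  refl: "w \<noteq> [] \<Longrightarrow> set w \<subseteq> generators G \<Longrightarrow> gis_cong G w w"
| sym: "gis_cong G u v \<Longrightarrow> gis_cong G v u"
| trans: "gis_cong G u v \<Longrightarrow> gis_cong G v w \<Longrightarrow> gis_cong G u w"
| mult_left: "gis_cong G u v \<Longrightarrow> x \<in> generators G \<Longrightarrow> gis_cong G (x # u) (x # v)"
| mult_right: "gis_cong G u v \<Longrightarrow> x \<in> generators G \<Longrightarrow> gis_cong G (u @ [x]) (v @ [x])"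
| zero_left: "x \<in> generators G \<Longrightarrow> gis_cong G [Zero, x] [Zero]"
| zero_right: "x \<in> generators G \<Longrightarrow> gis_cong G [x, Zero] [Zero]"
| idem: "V \<in> verts G \<Longrightarrow> gis_cong G [Idem V, Idem V] [Idem V]"
| idem_orth: "U \<in> verts G \<Longrightarrow> W \<in> verts G \<Longrightarrow> U \<noteq> W \<Longrightarrow> gis_cong G [Idem U, Idem W] [Zero]"
| neg_pos_same: "f \<in> arcs G \<Longrightarrow> gis_cong G [Sym (Neg f), Sym (Pos f)] [Idem (tail G f)]"
| neg_pos_diff: "f \<in> arcs G \<Longrightarrow> g \<in> arcs G \<Longrightarrow> f \<noteq> g \<Longrightarrow>
    gis_cong G [Sym (Neg f), Sym (Pos g)] [Zero]"
| tail_neg: "f \<in> arcs G \<Longrightarrow> gis_cong G [Idem (tail G f), Sym (Neg f)] [Sym (Neg f)]"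
| neg_head: "f \<in> arcs G \<Longrightarrow> gis_cong G [Sym (Neg f), Idem (head G f)] [Sym (Neg f)]"
| head_pos: "f \<in> arcs G \<Longrightarrow> gis_cong G [Idem (head G f), Sym (Pos f)] [Sym (Pos f)]"
| pos_tail: "f \<in> arcs G \<Longrightarrow> gis_cong G [Sym (Pos f), Idem (tail G f)] [Sym (Pos f)]"

text \<open>
  Elements of the semigroup are congruence classes, multiplied by concatenating representatives.
  Hence the product of the letters of a nonempty word \<open>w\<close> is the class of \<open>w\<close>.
\<close>

definition gis_prod ::
  "('v, 'e) pre_digraph \<Rightarrow> ('v, 'e) generator list \<Rightarrow> ('v, 'e) generator list set" where
  "gis_prod G w = {w'. gis_cong G w w'}"

definition gis_zero :: "('v, 'e) pre_digraph \<Rightarrow> ('v, 'e) generator list set" where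
  "gis_zero G = gis_prod G [Zero]"


section \<open>Markov-Dyck shifts\<close>

definition admissible :: "('v, 'e) pre_digraph \<Rightarrow> 'e symbol list \<Rightarrow> bool" where
  "admissible G w \<longleftrightarrow> set w \<subseteq> symbols G \<and> gis_prod G (map Sym w) \<noteq> gis_zero G"

definition markov_dyck_shift :: "('v, 'e) pre_digraph \<Rightarrow> (int \<Rightarrow> 'e symbol) set" where
  "markov_dyck_shift G = {p. \<forall>i j. i \<le> j \<longrightarrow> admissible G (map p [i..j])}"

definition shift :: "(int \<Rightarrow> 'a) \<Rightarrow> (int \<Rightarrow> 'a)" where
  "shift p = (\<lambda>i. p (i + 1))"

definition has_least_period :: "(int \<Rightarrow> 'a) \<Rightarrow> nat \<Rightarrow> bool" where
  "has_least_period p k \<longleftrightarrow>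
     k > 0 \<and> (shift ^^ k) p = p \<and> (\<forall>m. 0 < m \<and> m < k \<longrightarrow> (shift ^^ m) p \<noteq> p)"


section \<open>The subtree of a graph\<close>

definition tree_arcs :: "('v, 'e) pre_digraph \<Rightarrow> 'e set" where
  "tree_arcs G = {f \<in> arcs G. in_arcs G (head G f) = {f}}"

definition nontree_arcs :: "('v, 'e) pre_digraph \<Rightarrow> 'e set" where
  "nontree_arcs G = arcs G - tree_arcs G"

definition subtree :: "('v, 'e) pre_digraph \<Rightarrow> ('v, 'e) pre_digraph" where
  "subtree G = G\<lparr>arcs := tree_arcs G\<rparr>"

definition directed_tree :: "('v, 'e) pre_digraph \<Rightarrow> 'v \<Rightarrow> bool" where
  "directed_tree T r \<longleftrightarrow>
     r \<in> verts T \<and> (\<forall>v \<in> verts T. \<exists>!p. pre_digraph.awalk T r p v)"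

definition level :: "('v, 'e) pre_digraph \<Rightarrow> 'v \<Rightarrow> 'v \<Rightarrow> nat" where
  "level T r v = (LEAST n. \<exists>p. pre_digraph.awalk T r p v \<and> length p = n)"

definition leaves :: "('v, 'e) pre_digraph \<Rightarrow> 'v set" where
  "leaves T = {v \<in> verts T. out_degree T v = 0}"

definition uniform_height :: "('v, 'e) pre_digraph \<Rightarrow> 'v \<Rightarrow> nat \<Rightarrow> bool" where
  "uniform_height G r h \<longleftrightarrow>
     (\<forall>v \<in> leaves (subtree G). level (subtree G) r v = h) \<and>
     (\<forall>e \<in> nontree_arcs G. level (subtree G) r (tail G e) = h)"

definition spherically_homogeneous :: "('v, 'e) pre_digraph \<Rightarrow> 'v \<Rightarrow> bool" where
  "spherically_homogeneous G r \<longleftrightarrow>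
     (\<forall>u \<in> leaves (subtree G). \<forall>v \<in> leaves (subtree G).
        level (subtree G) r u = level (subtree G) r v) \<and>
     (\<forall>u \<in> verts G. \<forall>v \<in> verts G. level (subtree G) r u = level (subtree G) r v \<longrightarrow>
        out_degree (subtree G) u = out_degree (subtree G) v) \<and>
     (\<forall>e \<in> nontree_arcs G. tail G e \<in> leaves (subtree G)) \<and>
     (\<forall>u \<in> leaves (subtree G). \<forall>v \<in> leaves (subtree G). out_degree G u = out_degree G v)"

text \<open>\<open>G\<close> consists of the vertices and arcs of a single directed cycle.\<close>

definition is_cycle_graph :: "('v, 'e) pre_digraph \<Rightarrow> bool" where
  "is_cycle_graph G \<longleftrightarrow>
     (\<exists>c. pre_digraph.cycle G c \<and> set c = arcs G \<and> tail G ` set c = verts G)"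


section \<open>Negative multipliers\<close>

definition bouquet :: "'e set \<Rightarrow> (unit, 'e) pre_digraph" where
  "bouquet A = \<lparr>verts = {()}, arcs = A, tail = (\<lambda>_. ()), head = (\<lambda>_. ())\<rparr>"

fun hat :: "('v, 'e) pre_digraph \<Rightarrow> 'e symbol \<Rightarrow> (unit, 'e) generator" where
  "hat G (Neg e) = (if e \<in> tree_arcs G then Idem () else Sym (Neg e))"
| "hat G (Pos e) = (if e \<in> tree_arcs G then Idem () else Sym (Pos e))"

text \<open>
  The products are taken in the Dyck inverse monoid, i.e. the graph inverse semigroup of the
  bouquet on the non-tree arcs, whose identity element is \<open>Idem ()\<close>.
\<close>

definition has_negative_multiplier ::
  "('v, 'e) pre_digraph \<Rightarrow> 'e \<Rightarrow> (int \<Rightarrow> 'e symbol) \<Rightarrow> nat \<Rightarrow> bool" where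
  "has_negative_multiplier G e p k \<longleftrightarrow>
     (\<exists>i M. M \<ge> 1 \<and>
        gis_prod (bouquet (nontree_arcs G)) (map (\<lambda>j. hat G (p j)) [i..i + int k - 1]) =
        gis_prod (bouquet (nontree_arcs G)) (replicate M (Sym (Neg e))))"

definition periodic_orbits :: "('v, 'e) pre_digraph \<Rightarrow> 'e \<Rightarrow> nat \<Rightarrow> (int \<Rightarrow> 'e symbol) set set" where
  "periodic_orbits G e k =
     {orbit shift p | p. p \<in> markov_dyck_shift G \<and> has_least_period p k \<and>
        has_negative_multiplier G e p k}"

definition num_orbits :: "('v, 'e) pre_digraph \<Rightarrow> 'e \<Rightarrow> nat \<Rightarrow> nat" where
  "num_orbits G e k = card (periodic_orbits G e k)"

end

theory Submission
  imports Defs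
begin

text \<open>
  Words act on stacks of arcs, a negative symbol pushing its arc and a positive one popping it;
  a word is nonzero in the graph inverse semigroup iff it acts somewhere. In the projection to the
  Dyck monoid only nontree arcs survive, so a point with negative multiplier \<open>e\<close> can be rotated to
  start at the root with the empty stack and to end, after each period, with the unique closed path
  through \<open>e\<close> stacked \<open>M\<close> times. Periods 5 and 10 force \<open>M = 1\<close> and \<open>M = 2\<close>. Counting the
  words that build such a stack by their last letter gives
  \<open>I 5 = A + n + m\<close> and \<open>I 10 = const + A m\<close>, where \<open>A\<close>, \<open>n\<close>, \<open>m\<close> are the out-degrees along the
  path through \<open>e\<close> and the constant depends only on \<open>A\<close>, \<open>n + m\<close> and the sum of the out-degrees
  at level one. Hence \<open>m\<close> and \<open>n\<close> do not depend on \<open>e\<close>.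
\<close>

section \<open>The action of words on stacks\<close>

text \<open>A stack with M entries \<open>e\<close> that returns to the root has 3M arcs, so a word
  with j pops that builds it has length 3M + 2j. With M >= 1, length 5 leaves only M = j = 1 and
  length 10 only M = j = 2. One pop sees just the out-degrees on the path, so period 5 yields only
  the sum c = n + m. Two pops also see out-degrees one arc off the path. Separating n from m rests
  on a cancellation: since c is constant, all children of a level-one vertex have the same
  out-degree m, so the walks of length two from it number n m. Twice this is exactly what the
  quadratic terms lack to be a polynomial in A and c. What remains is 2 A m, from the walks leaf -
  root - level one, and A > 0. The zero of the semigroup is given by a presentation. The action
  shows that words are nonzero; that all other words are zero needs normal forms.\<close>

fun cur :: "('v, 'e) pre_digraph \<Rightarrow> 'v \<Rightarrow> 'e list \<Rightarrow> 'v" where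
  "cur G b [] = b"
| "cur G b (a # s) = head G a"

text \<open>Stacks are listed top first. The tail test in the popping case makes f^+ 1_{s(f)} = f^+
  hold on arbitrary lists, not only on those that are paths.\<close>

fun act :: "('v, 'e) pre_digraph \<Rightarrow> 'v \<Rightarrow> ('v, 'e) generator \<Rightarrow> 'e list \<Rightarrow> 'e list option" where
  "act G b Zero s = None"
| "act G b (Idem v) s = (if cur G b s = v then Some s else None)"
| "act G b (Sym (Neg f)) s = (if f \<in> arcs G \<and> tail G f = cur G b s then Some (f # s) else None)"
| "act G b (Sym (Pos f)) [] = None"
| "act G b (Sym (Pos f)) (a # s) =
    (if a = f \<and> f \<in> arcs G \<and> tail G f = cur G b s then Some s else None)"

primrec run :: "('v, 'e) pre_digraph \<Rightarrow> 'v \<Rightarrow> ('v, 'e) generator list \<Rightarrow> 'e list \<Rightarrow> 'e list option"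
  where
  "run G b [] s = Some s"
| "run G b (x # w) s = Option.bind (act G b x s) (run G b w)"

lemma run_append: "run G b (u @ w) s = Option.bind (run G b u s) (run G b w)"
  by (induction u arbitrary: s) (auto split: bind_split)

lemma cur_append: "cur G b (s @ t) = cur G (cur G b t) s"
  by (cases s) auto

lemma act_lift:
  assumes "act G (cur G b t) x s = Some s'"
  shows "act G b x (s @ t) = Some (s' @ t)"
proof (cases x)
  case (Sym y)
  then show ?thesis
    using assms by (cases y; cases s) (auto simp: cur_append split: if_splits)
qed (use assms in \<open>auto simp: cur_append split: if_splits\<close>)

text \<open>A pop on the empty list fails, so a successful run never reaches below its starting
  stack and sees only the end vertex of what lies there, here the base
  \<open>cur G b t\<close>.\<close>

lemma run_lift:
  assumes "run G (cur G b t) w s = Some s'"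
  shows "run G b w (s @ t) = Some (s' @ t)"
  using assms
proof (induction w arbitrary: s)
  case (Cons x w)
  then obtain s1 where s1: "act G (cur G b t) x s = Some s1" "run G (cur G b t) w s1 = Some s'"
    by (auto split: bind_splits)
  then show ?case
    using Cons.IH[OF s1(2)] act_lift[OF s1(1)] by simp
qed auto

text \<open>The partial maps given by the generators satisfy every defining relation, so the action
  is defined on classes; this is how words are shown to be nonzero.\<close>

lemma gis_cong_run: "gis_cong G u w \<Longrightarrow> run G b u = run G b w"
proof (induction rule: gis_cong.induct)
  case (neg_pos_diff f g)
  then show ?case by (auto simp: fun_eq_iff)
next
  case (head_pos f)
  have "run G b [Idem (head G f), Sym (Pos f)] s = run G b [Sym (Pos f)] s" for s
    by (cases s) auto
  then show ?case by auto
next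
  case (pos_tail f)
  have "run G b [Sym (Pos f), Idem (tail G f)] s = run G b [Sym (Pos f)] s" for s
    by (cases s) auto
  then show ?case by auto
qed (auto simp: run_append fun_eq_iff split: bind_split)

section \<open>Zero and normal forms in the graph inverse semigroup\<close>

lemma gis_cong_generators:
  assumes "wf_digraph G" "gis_cong G u w"
  shows "u \<noteq> [] \<and> set u \<subseteq> generators G \<and> w \<noteq> [] \<and> set w \<subseteq> generators G"
  using assms(2)
  by induction
    (use assms(1) in \<open>auto simp: generators_def symbols_def wf_digraph.tail_in_verts wf_digraph.head_in_verts\<close>)

lemma gis_cong_context:
  assumes "gis_cong G u w" "set x \<subseteq> generators G" "set y \<subseteq> generators G"
  shows "gis_cong G (x @ u @ y) (x @ w @ y)"
proof -
  have *: "gis_cong G (u @ y) (w @ y)"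
    using assms(3)
  proof (induction y rule: rev_induct)
    case (snoc a y)
    then show ?case using gis_cong.mult_right[of G "u @ y" "w @ y" a] by simp
  qed (use assms in simp)
  show ?thesis
    using assms(2) by (induction x) (use * in \<open>auto intro: gis_cong.mult_left\<close>)
qed

lemma gis_cong_zero_context:
  assumes "gis_cong G u [Zero]" "set x \<subseteq> generators G" "set y \<subseteq> generators G"
  shows "gis_cong G (x @ u @ y) [Zero]"
proof -
  have Z: "Zero \<in> generators G" by (simp add: generators_def)
  have *: "gis_cong G (Zero # y) [Zero]"
    using assms(3)
  proof (induction y)
    case (Cons a y)
    then show ?case
      using gis_cong_context[OF gis_cong.zero_left[of a G], of "[]" y]
      by (auto intro: gis_cong.trans)
  qed (simp add: gis_cong.refl Z)
  have "gis_cong G (x @ Zero # y) [Zero]"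
    using assms(2)
  proof (induction x)
    case (Cons a x)
    then show ?case
      using gis_cong.mult_left[of G "x @ Zero # y" "[Zero]" a] gis_cong.zero_right[of a G]
      by (auto intro: gis_cong.trans)
  qed (use * in simp)
  then show ?thesis
    using gis_cong_context[OF assms] by (auto intro: gis_cong.trans)
qed

text \<open>The normal form: pops, then pushes. The idempotent in the middle keeps the word nonempty
  when both lists are empty.\<close>

definition reduced :: "'e list \<Rightarrow> 'v \<Rightarrow> 'e list \<Rightarrow> ('v, 'e) generator list" where
  "reduced us v vs = map (\<lambda>f. Sym (Pos f)) us @ Idem v # map (\<lambda>f. Sym (Neg f)) vs"

lemma run_Neg: "run G b (map (\<lambda>f. Sym (Neg f)) vs) s = Some t \<Longrightarrow> t = rev vs @ s"
  by (induction vs arbitrary: s) (auto split: if_splits)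

text \<open>The run from \<open>us\<close> to \<open>rev vs\<close> certifies that the normal form
  is nonzero, and its end vertex is what a following letter is compared with.\<close>

definition reducible :: "('v, 'e) pre_digraph \<Rightarrow> ('v, 'e) generator list \<Rightarrow> bool" where
  "reducible G w \<longleftrightarrow> gis_cong G w [Zero] \<or>
     (\<exists>us v vs b. gis_cong G w (reduced us v vs) \<and> run G b (reduced us v vs) us = Some (rev vs))"

context wf_digraph
begin

text \<open>The normal form ends in its idempotent or in a push, and both absorb the idempotent of
  their end vertex on the right.\<close>

lemma reduced_absorb:
  assumes "run G b (reduced us v vs) us = Some (rev vs)"
    and "set (reduced us v vs) \<subseteq> generators G"
  shows "gis_cong G (reduced us v vs) (reduced us v vs @ [Idem (cur G b (rev vs))])"
    and "cur G b (rev vs) \<in> verts G"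
proof -
  define c where "c = cur G b (rev vs)"
  have "\<exists>y0 y. reduced us v vs = y0 @ [y] \<and> gis_cong G [y] [y, Idem c] \<and> c \<in> verts G"
  proof (cases vs rule: rev_cases)
    case Nil
    have "c = v"
      using assms(1) Nil by (auto simp: reduced_def run_append c_def split: bind_splits if_splits)
    moreover have "v \<in> verts G"
      using assms(2) by (auto simp: reduced_def generators_def)
    ultimately show ?thesis
      using Nil by (auto simp: reduced_def intro: gis_cong.sym gis_cong.idem)
  next
    case (snoc vs' g)
    have "c = head G g" using snoc by (simp add: c_def)
    moreover have "g \<in> arcs G"
      using assms(2) snoc by (auto simp: reduced_def generators_def symbols_def)
    ultimately show ?thesis
      using snoc by (intro exI[of _ "reduced us v vs'"] exI[of _ "Sym (Neg g)"])
        (auto simp: reduced_def intro: gis_cong.sym gis_cong.neg_head)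
  qed
  then obtain y0 y where y: "reduced us v vs = y0 @ [y]" "gis_cong G [y] [y, Idem c]" "c \<in> verts G"
    by blast
  have "gis_cong G (y0 @ [y]) (y0 @ [y, Idem c])"
    using gis_cong_context[OF y(2), of y0 "[]"] assms(2) y(1) by simp
  then show "gis_cong G (reduced us v vs) (reduced us v vs @ [Idem (cur G b (rev vs))])"
    using y(1) by (simp add: c_def)
  show "cur G b (rev vs) \<in> verts G"
    using y(3) by (simp add: c_def)
qed

text \<open>If the initial vertex of \<open>x\<close> differs from the end vertex, inserting both
  idempotents gives zero. Otherwise a push lengthens \<open>vs\<close>, while a pop cancels the last
  push or gives zero, and lengthens \<open>us\<close> if there is no push.\<close>

lemma reducible_snoc:
  assumes "reducible G w" "set w \<subseteq> generators G" "x \<in> generators G"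
  shows "reducible G (w @ [x])"
proof (cases "gis_cong G w [Zero]")
  case True
  then show ?thesis
    using gis_cong_zero_context[of G w "[]" "[x]"] assms(3) by (simp add: reducible_def)
next
  case False
  then obtain us v vs b where nf: "gis_cong G w (reduced us v vs)"
    and rn: "run G b (reduced us v vs) us = Some (rev vs)"
    using assms(1) by (auto simp: reducible_def)
  let ?N = "reduced us v vs"
  let ?c = "cur G b (rev vs)"
  have gen: "set ?N \<subseteq> generators G"
    using gis_cong_generators[OF wf_digraph_axioms nf] by blast
  note ab = reduced_absorb[OF rn gen]
  have wx: "gis_cong G (w @ [x]) (?N @ [x])"
    using gis_cong.mult_right[OF nf assms(3)] .
  have Nc: "gis_cong G (?N @ [x]) (?N @ [Idem ?c, x])"
    using gis_cong.mult_right[OF ab(1) assms(3)] by simp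
  have zero: "reducible G (w @ [x])" if "gis_cong G [Idem ?c, x] [Zero]"
    using gis_cong_zero_context[OF that gen, of "[]"] wx Nc
    by (auto simp: reducible_def intro: gis_cong.trans)
  have orth: "gis_cong G [Idem ?c, x] [Zero]"
    if "V \<in> verts G" "V \<noteq> ?c" "gis_cong G [Idem V, x] [x]" for V
  proof -
    have "gis_cong G [Idem ?c, x] [Idem ?c, Idem V, x]"
      using gis_cong_context[OF gis_cong.sym[OF that(3)], of "[Idem ?c]" "[]"] ab(2)
      by (simp add: generators_def)
    moreover have "gis_cong G [Idem ?c, Idem V, x] [Zero]"
      using gis_cong_zero_context[OF gis_cong.idem_orth[OF ab(2) that(1)], of "[]" "[x]"] that assms(3)
      by auto
    ultimately show ?thesis by (rule gis_cong.trans)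
  qed
  show ?thesis
  proof (cases x)
    case Zero
    then show ?thesis
      using zero gis_cong.zero_right[of "Idem ?c" G] ab(2) by (simp add: generators_def)
  next
    case (Idem V)
    have V: "V \<in> verts G" using assms(3) Idem by (auto simp: generators_def)
    show ?thesis
    proof (cases "V = ?c")
      case True
      then have "gis_cong G (w @ [x]) ?N"
        using wx gis_cong.sym[OF ab(1)] Idem by (auto intro: gis_cong.trans)
      then show ?thesis using rn by (auto simp: reducible_def)
    next
      case False
      then show ?thesis using zero orth[of V] V Idem gis_cong.idem[OF V] by simp
    qed
  next
    case (Sym y)
    show ?thesis
    proof (cases y)
      case (Neg f)
      have f: "f \<in> arcs G" using assms(3) Sym Neg by (auto simp: generators_def symbols_def)
      show ?thesis
      proof (cases "tail G f = ?c")
        case True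
        have "?N @ [x] = reduced us v (vs @ [f])" by (simp add: reduced_def Sym Neg)
        moreover have "run G b (?N @ [x]) us = Some (rev (vs @ [f]))"
          by (simp add: run_append rn Sym Neg f True)
        ultimately show ?thesis using wx unfolding reducible_def by metis
      next
        case False
        then show ?thesis
          using zero orth[of "tail G f"] f gis_cong.tail_neg[OF f] Sym Neg by simp
      qed
    next
      case (Pos f)
      have f: "f \<in> arcs G" using assms(3) Sym Pos by (auto simp: generators_def symbols_def)
      show ?thesis
      proof (cases vs rule: rev_cases)
        case Nil
        have rN: "?N = map (\<lambda>f. Sym (Pos f)) us @ [Idem v]" using Nil by (simp add: reduced_def)
        then have bv: "b = v" and rp: "run G v (map (\<lambda>f. Sym (Pos f)) us) us = Some []"
          using rn Nil by (auto simp: run_append split: bind_splits if_splits)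
        show ?thesis
        proof (cases "head G f = v")
          case True
          let ?P = "map (\<lambda>f. Sym (Pos f)) us"
          have gP: "set ?P \<subseteq> generators G" using gen by (auto simp: reduced_def)
          have 1: "gis_cong G (?P @ [Idem v, x]) (?P @ [x])"
            using gis_cong_context[OF gis_cong.head_pos[OF f] gP, of "[]"] True Sym Pos by simp
          have 2: "gis_cong G (?P @ [x]) (?P @ [x, Idem (tail G f)])"
            using gis_cong_context[OF gis_cong.sym[OF gis_cong.pos_tail[OF f]] gP, of "[]"] Sym Pos
            by simp
          have N: "?N @ [x] = ?P @ [Idem v, x]" by (simp add: rN)
          have 3: "?P @ [x, Idem (tail G f)] = reduced (us @ [f]) (tail G f) []"
            by (simp add: reduced_def Sym Pos)
          have "gis_cong G (w @ [x]) (reduced (us @ [f]) (tail G f) [])"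
            using wx 1 2 unfolding N 3 by (blast intro: gis_cong.trans)
          \<comment> \<open>The base moves from \<open>v\<close> to the tail of \<open>f\<close>:
            the new bottom entry \<open>f\<close> has head \<open>v\<close>, so the old pops take
            place above it.\<close>
          moreover have "run G (tail G f) ?P (us @ [f]) = Some ([] @ [f])"
            using run_lift[of G "tail G f" "[f]" ?P us "[]"] rp True by simp
          then have "run G (tail G f) (reduced (us @ [f]) (tail G f) []) (us @ [f]) = Some (rev [])"
            by (simp add: reduced_def run_append f)
          ultimately show ?thesis unfolding reducible_def by blast
        next
          case False
          then show ?thesis
            using zero orth[of "head G f"] f gis_cong.head_pos[OF f] Sym Pos Nil bv by simp
        qed
      next
        case (snoc vs' g)
        have g: "g \<in> arcs G" using gen snoc by (auto simp: reduced_def generators_def symbols_def)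
        have N: "?N @ [x] = reduced us v vs' @ [Sym (Neg g), Sym (Pos f)]"
          by (simp add: reduced_def snoc Sym Pos)
        have gen': "set (reduced us v vs') \<subseteq> generators G"
          using gen snoc by (auto simp: reduced_def)
        show ?thesis
        proof (cases "g = f")
          case True
          have "?N = reduced us v vs' @ [Sym (Neg g)]" by (simp add: reduced_def snoc)
          then have rn': "run G b (reduced us v vs') us = Some (rev vs')"
            and t: "tail G g = cur G b (rev vs')"
            using rn snoc by (auto simp: run_append split: bind_splits if_splits)
          have "gis_cong G (?N @ [x]) (reduced us v vs' @ [Idem (tail G f)])"
            using gis_cong_context[OF gis_cong.neg_pos_same[OF f] gen', of "[]"]
            unfolding N True by simp
          then have "gis_cong G (w @ [x]) (reduced us v vs')"
            using wx gis_cong.sym[OF reduced_absorb(1)[OF rn' gen']] t True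
            by (metis gis_cong.trans)
          then show ?thesis using rn' unfolding reducible_def by blast
        next
          case False
          have "gis_cong G (?N @ [x]) [Zero]"
            using gis_cong_zero_context[OF gis_cong.neg_pos_diff[OF g f False] gen', of "[]"] N by simp
          then show ?thesis using wx unfolding reducible_def by (blast intro: gis_cong.trans)
        qed
      qed
    qed
  qed
qed

lemma reducible_generators:
  assumes "w \<noteq> []" "set w \<subseteq> generators G"
  shows "reducible G w"
  using assms
proof (induction w rule: rev_nonempty_induct)
  case (single x)
  have idem: "reducible G [Idem c]" if "c \<in> verts G" for c
    unfolding reducible_def
    by (rule disjI2, rule exI[of _ "[]"], rule exI[of _ c], rule exI[of _ "[]"], rule exI[of _ c])
      (use that in \<open>auto simp: reduced_def generators_def intro: gis_cong.refl\<close>)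
  \<comment> \<open>A single letter is treated as an extension of the idempotent at its initial
    vertex.\<close>
  have red: "reducible G [x]" if "gis_cong G [Idem c, x] [x]" "c \<in> verts G" for c
  proof -
    have "reducible G ([Idem c] @ [x])"
      using reducible_snoc[OF idem[OF that(2)], of x] single that(2) by (simp add: generators_def)
    then show ?thesis
      using gis_cong.sym[OF that(1)] unfolding reducible_def
      by (metis append_Cons append_Nil gis_cong.trans)
  qed
  show ?case
  proof (cases x)
    case Zero
    then show ?thesis
      using single by (auto simp: reducible_def intro: gis_cong.refl)
  next
    case (Idem v)
    then show ?thesis using idem single by (auto simp: generators_def)
  next
    case (Sym y)
    show ?thesis
    proof (cases y)
      case (Neg f)
      then have "f \<in> arcs G" using single Sym by (auto simp: generators_def symbols_def)
      then show ?thesis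
        using red[of "tail G f"] gis_cong.tail_neg[of f G] Sym Neg by simp
    next
      case (Pos f)
      then have "f \<in> arcs G" using single Sym by (auto simp: generators_def symbols_def)
      then show ?thesis
        using red[of "head G f"] gis_cong.head_pos[of f G] Sym Pos by simp
    qed
  qed
next
  case (snoc x w)
  then show ?case using reducible_snoc[of w x] by auto
qed

text \<open>A nonzero word has a normal form together with a run of it, and congruent words act
  alike; conversely \<open>Zero\<close> acts nowhere.\<close>

lemma not_zero_iff_run:
  assumes "w \<noteq> []" "set w \<subseteq> generators G"
  shows "\<not> gis_cong G w [Zero] \<longleftrightarrow> (\<exists>b s t. run G b w s = Some t)"
proof
  assume "\<not> gis_cong G w [Zero]"
  then show "\<exists>b s t. run G b w s = Some t"
    using reducible_generators[OF assms] gis_cong_run unfolding reducible_def by metis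
next
  assume "\<exists>b s t. run G b w s = Some t"
  then show "\<not> gis_cong G w [Zero]"
    using gis_cong_run by force
qed

text \<open>A pop fails on the empty stack, so the normal form has no pops, and the stack that it
  leaves spells out its pushes. Hence one run determines the class.\<close>

lemma gis_cong_run_result:
  assumes "w \<noteq> []" "set w \<subseteq> generators G" "run G b w [] = Some t"
  shows "gis_cong G w (Idem b # map (\<lambda>f. Sym (Neg f)) (rev t))"
proof -
  have "\<not> gis_cong G w [Zero]" using not_zero_iff_run assms by blast
  then obtain us v vs where nf: "gis_cong G w (reduced us v vs)"
    using reducible_generators[OF assms(1,2)] unfolding reducible_def by blast
  have r: "run G b (reduced us v vs) [] = Some t"
    using gis_cong_run[OF nf] assms(3) by metis
  then have "us = []" by (cases us) (auto simp: reduced_def)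
  then have "v = b" "t = rev vs"
    using r run_Neg[of G b vs "[]" t] by (auto simp: reduced_def split: if_splits)
  then show ?thesis using nf \<open>us = []\<close> by (simp add: reduced_def)
qed

end

section \<open>Words in the letters e^-, e^+ and their stack height\<close>

abbreviation runs :: "('v, 'e) pre_digraph \<Rightarrow> 'v \<Rightarrow> 'e symbol list \<Rightarrow> 'e list \<Rightarrow> 'e list option"
  where "runs G b w s \<equiv> run G b (map Sym w) s"

primrec src :: "('v, 'e) pre_digraph \<Rightarrow> 'e symbol \<Rightarrow> 'v" where
  "src G (Neg f) = tail G f"
| "src G (Pos f) = head G f"

primrec tgt :: "('v, 'e) pre_digraph \<Rightarrow> 'e symbol \<Rightarrow> 'v" where
  "tgt G (Neg f) = head G f"
| "tgt G (Pos f) = tail G f"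

primrec ht :: "'e symbol \<Rightarrow> int" where
  "ht (Neg f) = 1"
| "ht (Pos f) = -1"

fun valid :: "('v, 'e) pre_digraph \<Rightarrow> 'v \<Rightarrow> 'e list \<Rightarrow> bool" where
  "valid G b [] \<longleftrightarrow> True"
| "valid G b (a # s) \<longleftrightarrow> a \<in> arcs G \<and> tail G a = cur G b s \<and> valid G b s"

lemma act_Sym:
  assumes "act G b (Sym x) s = Some s'"
  shows "cur G b s = src G x" "cur G b s' = tgt G x" "x \<in> symbols G"
    "int (length s') = int (length s) + ht x" "valid G b s \<Longrightarrow> valid G b s'"
  using assms by (cases x; cases s; auto simp: symbols_def split: if_splits)+

lemma runs_symbols: "runs G b w s = Some s' \<Longrightarrow> set w \<subseteq> symbols G"
  by (induction w arbitrary: s) (auto split: bind_splits dest: act_Sym)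

lemma runs_length:
  "runs G b w s = Some s' \<Longrightarrow> int (length s') = int (length s) + sum_list (map ht w)"
  by (induction w arbitrary: s) (fastforce split: bind_splits dest: act_Sym(4))+

lemma runs_valid: "runs G b w s = Some s' \<Longrightarrow> valid G b s \<Longrightarrow> valid G b s'"
  by (induction w arbitrary: s) (auto split: bind_splits dest: act_Sym(5))

lemma runs_append_Some:
  "runs G b (u @ w) s = Some t \<longleftrightarrow> (\<exists>s'. runs G b u s = Some s' \<and> runs G b w s' = Some t)"
  by (auto simp: run_append split: bind_splits)

text \<open>The entry \<open>a\<close> of the final stack was pushed at some moment and not popped
  afterwards. What follows that push runs above \<open>a\<close> and depends on it only through its
  head.\<close>

lemma runs_split:
  assumes "runs G b w [] = Some (s2 @ a # s1)"
  obtains x1 x2 where "w = x1 @ Neg a # x2" "runs G b x1 [] = Some s1"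
    "runs G (head G a) x2 [] = Some s2" "a \<in> arcs G" "tail G a = cur G b s1"
proof -
  have "\<exists>x1 x2. w = x1 @ Neg a # x2 \<and> runs G b x1 [] = Some s1 \<and>
    runs G (head G a) x2 [] = Some s2 \<and> a \<in> arcs G \<and> tail G a = cur G b s1"
    using assms
  proof (induction w arbitrary: s2 rule: rev_induct)
    case (snoc x w)
    then obtain s where s: "runs G b w [] = Some s" "act G b (Sym x) s = Some (s2 @ a # s1)"
      by (auto simp: run_append split: bind_splits)
    show ?case
    proof (cases x)
      case (Neg f)
      have f: "f \<in> arcs G" "tail G f = cur G b s" "f # s = s2 @ a # s1"
        using s(2) Neg by (auto split: if_splits)
      show ?thesis
      proof (cases s2)
        case Nil
        then show ?thesis using f s(1) Neg by (intro exI[of _ w] exI[of _ "[]"]) auto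
      next
        case (Cons c s2')
        with f have c: "c = f" "s = s2' @ a # s1" by auto
        with snoc.IH[of s2'] s(1) obtain x1 x2 where *: "w = x1 @ Neg a # x2" "runs G b x1 [] = Some s1"
          "runs G (head G a) x2 [] = Some s2'" "a \<in> arcs G" "tail G a = cur G b s1" by auto
        have "runs G (head G a) (x2 @ [x]) [] = Some s2"
          using *(3) f c Neg Cons by (simp add: run_append cur_append)
        then show ?thesis using * by (intro exI[of _ x1] exI[of _ "x2 @ [x]"]) simp
      qed
    next
      case (Pos f)
      then have f: "f \<in> arcs G" "s = f # s2 @ a # s1" "tail G f = cur G b (s2 @ a # s1)"
        using s(2) by (cases s; auto split: if_splits)+
      \<comment> \<open>Before the pop the arc \<open>f\<close> also lay above \<open>a\<close>, so
        the induction hypothesis is used for the longer upper part.\<close>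
      with snoc.IH[of "f # s2"] s(1) obtain x1 x2 where *: "w = x1 @ Neg a # x2"
        "runs G b x1 [] = Some s1"
        "runs G (head G a) x2 [] = Some (f # s2)" "a \<in> arcs G" "tail G a = cur G b s1" by auto
      have "runs G (head G a) (x2 @ [x]) [] = Some s2"
        using *(3) f Pos by (simp add: run_append cur_append)
      then show ?thesis using * by (intro exI[of _ x1] exI[of _ "x2 @ [x]"]) simp
    qed
  qed simp
  then show thesis using that by blast
qed

text \<open>If no prefix has negative height, nothing of \<open>s\<close> is ever popped. This
  strips off the unknown stack that admissibility provides.\<close>

lemma runs_nonneg:
  assumes "runs G b w s = Some t" "\<And>n. n \<le> length w \<Longrightarrow> sum_list (map ht (take n w)) \<ge> 0"
  shows "\<exists>t'. runs G (cur G b s) w [] = Some t' \<and> t = t' @ s"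
  using assms
proof (induction w arbitrary: t rule: rev_induct)
  case (snoc x w)
  then obtain t0 where t0: "runs G b w s = Some t0" "act G b (Sym x) t0 = Some t"
    by (auto simp: run_append split: bind_splits)
  have "sum_list (map ht (take n w)) \<ge> 0" if "n \<le> length w" for n
    using snoc.prems(2)[of n] that by simp
  from snoc.IH[OF t0(1) this] obtain t' where t': "runs G (cur G b s) w [] = Some t'" "t0 = t' @ s"
    by auto
  have l: "int (length t') = sum_list (map ht w)" using runs_length[OF t'(1)] by simp
  show ?case
  proof (cases x)
    case (Neg f)
    then show ?thesis
      using t0(2) t' by (auto simp: run_append cur_append split: if_splits)
  next
    case (Pos f)
    have "sum_list (map ht w) \<ge> 1" using snoc.prems(2)[of "Suc (length w)"] Pos by simp
    then obtain a t'' where "t' = a # t''" using l by (cases t') auto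
    then show ?thesis
      using t0(2) t' Pos by (auto simp: run_append cur_append split: if_splits)
  qed
qed simp


section \<open>Projection to the Dyck inverse monoid\<close>

definition nt :: "('v, 'e) pre_digraph \<Rightarrow> 'e list \<Rightarrow> 'e list" where
  "nt G s = filter (\<lambda>a. a \<notin> tree_arcs G) s"

abbreviation hruns :: "('v, 'e) pre_digraph \<Rightarrow> 'e symbol list \<Rightarrow> 'e list \<Rightarrow> 'e list option" where
  "hruns G w s \<equiv> run (bouquet (nontree_arcs G)) () (map (hat G) w) s"

primrec hht :: "('v, 'e) pre_digraph \<Rightarrow> 'e symbol \<Rightarrow> int" where
  "hht G (Neg f) = (if f \<in> tree_arcs G then 0 else 1)"
| "hht G (Pos f) = (if f \<in> tree_arcs G then 0 else -1)"

lemma wf_bouquet: "wf_digraph (bouquet A)"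
  by unfold_locales (auto simp: bouquet_def)

lemma hat_generators: "x \<in> symbols G \<Longrightarrow> hat G x \<in> generators (bouquet (nontree_arcs G))"
  by (cases x) (auto simp: generators_def symbols_def bouquet_def nontree_arcs_def)

text \<open>Erasing the tree arcs of a stack turns the action of a letter into that of its
  projection; letters over tree arcs become the idempotent of the single vertex, which acts
  everywhere.\<close>

lemma act_hat:
  assumes "act G b (Sym x) s = Some s'"
  shows "act (bouquet (nontree_arcs G)) () (hat G x) (nt G s) = Some (nt G s')"
  using assms by (cases x; cases s) (auto simp: nt_def bouquet_def nontree_arcs_def split: if_splits)

lemma hruns_nt: "runs G b w s = Some s' \<Longrightarrow> hruns G w (nt G s) = Some (nt G s')"
  by (induction w arbitrary: s) (fastforce split: bind_splits dest: act_hat)+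

lemma hruns_append: "hruns G (u @ w) s = Option.bind (hruns G u s) (hruns G w)"
  by (simp add: run_append)

lemma hruns_lift: "hruns G w s = Some s' \<Longrightarrow> hruns G w (s @ t) = Some (s' @ t)"
  by (rule run_lift) simp

lemma act_hat_length:
  "act (bouquet (nontree_arcs G)) () (hat G x) s = Some s' \<Longrightarrow>
    int (length s') = int (length s) + hht G x"
  by (cases x; cases s) (auto split: if_splits)

lemma hruns_length:
  "hruns G w s = Some s' \<Longrightarrow> int (length s') = int (length s) + sum_list (map (hht G) w)"
  by (induction w arbitrary: s) (fastforce split: bind_splits dest: act_hat_length)+

lemma run_replicate_Neg:
  assumes "e \<in> nontree_arcs G"
  shows "run (bouquet (nontree_arcs G)) () (replicate M (Sym (Neg e))) s = Some (replicate M e @ s)"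
  using assms
  by (induction M arbitrary: s) (auto simp: bouquet_def replicate_app_Cons_same)

text \<open>A class that acts on the empty stack is determined by the stack it leaves there, so
  equality with the power of e^- is tested by one run. For \<open>M \<ge> 1\<close> that power is a
  nonempty word, hence an element of the free semigroup.\<close>

lemma negative_multiplier_iff:
  assumes "e \<in> nontree_arcs G" "w \<noteq> []" "set w \<subseteq> symbols G" "M \<ge> 1"
  shows "gis_prod (bouquet (nontree_arcs G)) (map (hat G) w) =
      gis_prod (bouquet (nontree_arcs G)) (replicate M (Sym (Neg e)))
    \<longleftrightarrow> hruns G w [] = Some (replicate M e)"
proof -
  let ?B = "bouquet (nontree_arcs G)"
  let ?R = "replicate M (Sym (Neg e)) :: (unit, 'a) generator list"
  interpret bq: wf_digraph ?B by (rule wf_bouquet)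
  have gen: "map (hat G) w \<noteq> []" "set (map (hat G) w) \<subseteq> generators ?B"
    using assms(2,3) hat_generators by auto
  have e: "e \<in> arcs ?B" using assms(1) by (simp add: bouquet_def)
  have genR: "?R \<noteq> []" "set ?R \<subseteq> generators ?B"
    using assms(1,4) by (auto simp: generators_def symbols_def bouquet_def)
  have eq: "gis_prod ?B (map (hat G) w) = gis_prod ?B ?R \<longleftrightarrow> gis_cong ?B (map (hat G) w) ?R"
    using gis_cong.refl[OF genR]
    by (auto simp: gis_prod_def intro: gis_cong.sym gis_cong.trans)
  also have "\<dots> \<longleftrightarrow> hruns G w [] = Some (replicate M e)"
  proof
    assume "gis_cong ?B (map (hat G) w) ?R"
    from gis_cong_run[OF this] show "hruns G w [] = Some (replicate M e)"
      using run_replicate_Neg[OF assms(1), of M "[]"] by simp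
  next
    assume "hruns G w [] = Some (replicate M e)"
    from bq.gis_cong_run_result[OF gen this]
    have 1: "gis_cong ?B (map (hat G) w) (Idem () # ?R)" by (simp add: map_replicate_const)
    obtain M' where M: "M = Suc M'" using assms(4) by (cases M) auto
    have "gis_cong ?B ([Idem ()] @ [Sym (Neg e)]) [Sym (Neg e)]"
      using gis_cong.tail_neg[OF e] by simp
    from gis_cong_context[OF this, of "[]" "replicate M' (Sym (Neg e))"]
    have "gis_cong ?B (Idem () # ?R) ?R" using genR M by (auto simp: set_replicate_conv_if)
    then show "gis_cong ?B (map (hat G) w) ?R" using 1 by (rule gis_cong.trans[rotated])
  qed
  finally show ?thesis .
qed

lemma (in wf_digraph) admissible_iff:
  assumes "w \<noteq> []"
  shows "admissible G w \<longleftrightarrow> set w \<subseteq> symbols G \<and> (\<exists>b s t. runs G b w s = Some t)"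
proof (cases "set w \<subseteq> symbols G")
  case True
  have gen: "map Sym w \<noteq> []" "set (map Sym w) \<subseteq> generators G"
    using True assms by (auto simp: generators_def)
  have "gis_prod G (map Sym w) = gis_zero G \<longleftrightarrow> gis_cong G (map Sym w) [Zero]"
    using gis_cong.refl[of "[Zero]" G]
    by (auto simp: gis_prod_def gis_zero_def generators_def intro: gis_cong.sym gis_cong.trans)
  then show ?thesis
    using True not_zero_iff_run[OF gen] by (simp add: admissible_def)
qed (simp add: admissible_def)

section \<open>Finite windows of bi-infinite sequences\<close>

definition wd :: "(int \<Rightarrow> 'a) \<Rightarrow> int \<Rightarrow> nat \<Rightarrow> 'a list" where
  "wd p i n = map (\<lambda>t. p (i + int t)) [0..<n]"

lemma length_wd [simp]: "length (wd p i n) = n"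
  by (simp add: wd_def)

lemma nth_wd [simp]: "t < n \<Longrightarrow> wd p i n ! t = p (i + int t)"
  by (simp add: wd_def)

lemma map_upto_wd: "map f [i..i + int n - 1] = wd f i n"
  by (rule nth_equalityI) auto

lemma wd_add: "wd p i (m + n) = wd p i m @ wd p (i + int m) n"
  by (rule nth_equalityI) (auto simp: nth_append)

lemma wd_Suc: "wd p i (Suc n) = wd p i n @ [p (i + int n)]"
  by (simp add: wd_def)

lemma shift_funpow: "(shift ^^ m) p = (\<lambda>i. p (i + int m))"
  by (induction m) (auto simp: shift_def fun_eq_iff algebra_simps)

lemma shift_funpow_fixed_iff: "(shift ^^ m) p = p \<longleftrightarrow> (\<forall>i. p (i + int m) = p i)"
  by (auto simp: shift_funpow fun_eq_iff)

section \<open>Levels in a subtree of uniform height two\<close>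

locale height_two = fin_digraph G for G :: "('v, 'e) pre_digraph" (structure) +
  fixes r :: 'v
  assumes connected: "strongly_connected G"
    and tree: "directed_tree (subtree G) r"
    and height: "uniform_height G r 2"
begin

abbreviation lev :: "'v \<Rightarrow> nat" where
  "lev \<equiv> level (subtree G) r"

lemma subtree_simps [simp]:
  "verts (subtree G) = verts G" "arcs (subtree G) = tree_arcs G"
  "tail (subtree G) = tail G" "head (subtree G) = head G"
  by (auto simp: subtree_def)

lemma tree_arcs_subset: "tree_arcs G \<subseteq> arcs G"
  by (auto simp: tree_arcs_def)

sublocale T: wf_digraph "subtree G"
  by unfold_locales (use tree_arcs_subset in auto)

lemma tree_arcsD: "f \<in> tree_arcs G \<Longrightarrow> f \<in> arcs G \<and> tail G f \<in> verts G \<and> head G f \<in> verts G"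
  using tree_arcs_subset by auto

lemma nontree_iff: "e \<in> arcs G \<Longrightarrow> e \<in> nontree_arcs G \<longleftrightarrow> e \<notin> tree_arcs G"
  by (auto simp: nontree_arcs_def)

lemma tree_arc_unique: "f \<in> tree_arcs G \<Longrightarrow> g \<in> arcs G \<Longrightarrow> head G f = head G g \<Longrightarrow> f = g"
  by (auto simp: tree_arcs_def in_arcs_def)

lemma root_vert: "r \<in> verts G"
  using tree by (simp add: directed_tree_def)

lemma tree_walk:
  assumes "v \<in> verts G"
  obtains q where "T.awalk r q v"
  using tree assms by (auto simp: directed_tree_def)

lemma tree_walk_unique:
  assumes "T.awalk r q v" "T.awalk r q' v"
  shows "q = q'"
proof -
  have "v \<in> verts (subtree G)" using assms(1) by blast
  then have "\<exists>!q. T.awalk r q v" using tree unfolding directed_tree_def by blast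
  then show ?thesis using assms by blast
qed

lemma lev_walk:
  assumes "T.awalk r q v"
  shows "lev v = length q"
  unfolding level_def
proof (rule Least_equality)
  show "\<exists>q'. T.awalk r q' v \<and> length q' = length q" using assms by blast
qed (use assms tree_walk_unique in blast)

lemma lev_root: "lev r = 0"
  using lev_walk[of "[]" r] root_vert by (simp add: T.awalk_Nil_iff)

lemma lev_0_iff:
  assumes "v \<in> verts G"
  shows "lev v = 0 \<longleftrightarrow> v = r"
proof
  assume "lev v = 0"
  moreover obtain q where q: "T.awalk r q v" using tree_walk[OF assms] .
  ultimately have "q = []" using lev_walk[OF q] by simp
  then show "v = r" using q by (simp add: T.awalk_Nil_iff)
qed (simp add: lev_root)

lemma lev_tree_arc:
  assumes "f \<in> tree_arcs G"
  shows "lev (head G f) = Suc (lev (tail G f))"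
proof -
  obtain q where q: "T.awalk r q (tail G f)"
    using tree_walk[of "tail G f"] tree_arcsD[OF assms] by auto
  have "T.awalk r (q @ [f]) (head G f)"
    using T.awalk_appendI[OF q, of "[f]" "head G f"] T.arc_implies_awalk[of f] assms by simp
  from lev_walk[OF this] lev_walk[OF q] show ?thesis by simp
qed

text \<open>A vertex other than the root is entered by the last arc of its tree walk, and a tree arc
  is the only arc into its head.\<close>

lemma head_nontree:
  assumes "e \<in> nontree_arcs G"
  shows "head G e = r"
proof (rule ccontr)
  assume neq: "head G e \<noteq> r"
  have e: "e \<in> arcs G" using assms by (simp add: nontree_arcs_def)
  then obtain q where q: "T.awalk r q (head G e)" using tree_walk[of "head G e"] by auto
  then have "q \<noteq> []" using neq by (auto simp: T.awalk_Nil_iff)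
  then obtain q' f where "q = q' @ [f]" by (cases q rule: rev_cases) auto
  with q have "f \<in> tree_arcs G" "head G f = head G e"
    by (auto simp: T.awalk_simps)
  then have "f = e" using tree_arc_unique e by blast
  then show False using \<open>f \<in> tree_arcs G\<close> assms by (simp add: nontree_arcs_def)
qed

lemma lev_tail_nontree: "e \<in> nontree_arcs G \<Longrightarrow> lev (tail G e) = 2"
  using height by (simp add: uniform_height_def)

lemma lev_leaf: "v \<in> leaves (subtree G) \<Longrightarrow> lev v = 2"
  using height by (simp add: uniform_height_def)

lemma finite_tree_arcs: "finite (tree_arcs G)"
  using finite_subset[OF tree_arcs_subset finite_arcs] .

lemma leaves_iff: "v \<in> leaves (subtree G) \<longleftrightarrow> v \<in> verts G \<and> (\<forall>f \<in> tree_arcs G. tail G f \<noteq> v)"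
proof -
  have "finite (out_arcs (subtree G) v)"
    by (rule finite_subset[OF _ finite_tree_arcs]) (auto simp: out_arcs_def)
  then show ?thesis by (auto simp: leaves_def out_degree_def out_arcs_def)
qed

text \<open>A vertex of maximal level is a leaf, since a tree arc leaving it would end one level
  higher; and leaves have level two.\<close>

lemma lev_le_2:
  assumes "v \<in> verts G"
  shows "lev v \<le> 2"
proof -
  have fin: "finite (lev ` verts G)" "lev ` verts G \<noteq> {}" using assms by auto
  obtain u where "u \<in> verts G" "lev u = Max (lev ` verts G)" using Max_in[OF fin] by auto
  then have u: "u \<in> verts G" "\<And>v. v \<in> verts G \<Longrightarrow> lev v \<le> lev u"
    using Max_ge[OF fin(1)] by simp_all
  have "u \<in> leaves (subtree G)"
    unfolding leaves_iff
  proof (intro conjI ballI notI u(1))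
    fix f assume f: "f \<in> tree_arcs G" "tail G f = u"
    then have "lev (head G f) \<le> lev u" using u(2)[of "head G f"] tree_arcsD[of f] by simp
    then show False using lev_tree_arc[OF f(1)] f(2) by simp
  qed
  then show ?thesis using u(2)[OF assms] lev_leaf by simp
qed

lemma leaves_iff_lev: "v \<in> leaves (subtree G) \<longleftrightarrow> v \<in> verts G \<and> lev v = 2"
proof
  assume *: "v \<in> verts G \<and> lev v = 2"
  have "tail G f \<noteq> v" if f: "f \<in> tree_arcs G" for f
  proof
    assume "tail G f = v"
    then have "lev (head G f) = 3" using lev_tree_arc[OF f] * by simp
    moreover have "head G f \<in> verts G" using tree_arcsD[OF f] by simp
    ultimately show False using lev_le_2[of "head G f"] by simp
  qed
  then show "v \<in> leaves (subtree G)" using * leaves_iff by blast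
next
  assume "v \<in> leaves (subtree G)"
  then show "v \<in> verts G \<and> lev v = 2" using leaves_iff lev_leaf by blast
qed

lemma lev_arc:
  assumes "f \<in> arcs G"
  shows "int (lev (head G f)) - int (lev (tail G f)) = (if f \<in> tree_arcs G then 1 else -2)"
  using lev_tree_arc[of f] head_nontree[of f] lev_tail_nontree[of f] nontree_iff[OF assms] lev_root
  by auto

text \<open>A tree arc changes the level by 1 and a nontree arc by -2 = 1 - 3. So the level is a
  potential: along a closed word the height gained is three times the height gained in the
  projection.\<close>

lemma lev_symbol:
  assumes "x \<in> symbols G"
  shows "int (lev (tgt G x)) - int (lev (src G x)) = ht x - 3 * hht G x"
proof (cases x)
  case (Neg f)
  then show ?thesis using assms lev_arc[of f] by (auto simp: symbols_def)
next
  case (Pos f)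
  then show ?thesis using assms lev_arc[of f] by (auto simp: symbols_def)
qed

lemma lev_cur:
  "valid G r s \<Longrightarrow> int (lev (cur G r s)) = int (length s) - 3 * int (length (nt G s))"
proof (induction s)
  case (Cons a s)
  then show ?case using lev_arc[of a] by (auto simp: nt_def)
qed (simp add: nt_def lev_root)

lemma cur_vert: "valid G b s \<Longrightarrow> b \<in> verts G \<Longrightarrow> cur G b s \<in> verts G"
  by (cases s) auto

lemma finite_symbols: "finite (symbols G)"
  by (simp add: symbols_def)

lemma finite_runs: "finite {w. length w = n \<and> runs G b w [] = Some s}"
  by (rule finite_subset[OF _ finite_lists_length_eq[OF finite_symbols, of n]])
    (auto dest: runs_symbols)

end

section \<open>The closed path through a nontree arc\<close>

locale return_arc = height_two G r for G :: "('v, 'e) pre_digraph" (structure) and r +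
  fixes e f1 f2 :: 'e
  assumes e: "e \<in> nontree_arcs G" and f1: "f1 \<in> tree_arcs G" and f2: "f2 \<in> tree_arcs G"
    and tail_f1: "tail G f1 = r" and head_f1: "head G f1 = tail G f2" and head_f2: "head G f2 = tail G e"
begin

lemma e_neq: "e \<noteq> f1" "e \<noteq> f2"
  using e f1 f2 by (auto simp: nontree_arcs_def)

lemma arcs_e: "e \<in> arcs G" "f1 \<in> arcs G" "f2 \<in> arcs G"
  using e f1 f2 tree_arcs_subset by (auto simp: nontree_arcs_def)

text \<open>The closed walk \<open>f1\<close>, \<open>f2\<close>, \<open>e\<close> at the root,
  traversed \<open>M\<close> times and listed top first, hence backwards.\<close>

definition cyc :: "nat \<Rightarrow> 'e list" where
  "cyc M = concat (replicate M [e, f2, f1])"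

lemma nt_cyc: "nt G (cyc M) = replicate M e"
  using e f1 f2 by (induction M) (auto simp: cyc_def nt_def nontree_arcs_def)

lemma length_cyc: "length (cyc M) = 3 * M"
  by (induction M) (auto simp: cyc_def)

lemma cur_cyc: "cur G r (cyc M) = r"
  using head_nontree[OF e] by (cases M) (auto simp: cyc_def)

lemma valid_cyc: "valid G r (cyc M)"
proof (induction M)
  case (Suc M)
  then show ?case
    using cur_cyc[of M] arcs_e tail_f1 head_f1 head_f2 by (simp add: cyc_def)
qed (simp add: cyc_def)

text \<open>Below the three top entries the height is a multiple of 3, so the level there, being at
  most 2, is 0. The next two arcs are then tree arcs and the top one is nontree, hence
  \<open>e\<close>; the arcs leading to its tail are forced, each being the only arc into its
  head.\<close>

lemma valid_eq_cyc:
  assumes "valid G r s" "nt G s = replicate M e" "length s = 3 * M"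
  shows "s = cyc M"
  using assms
proof (induction M arbitrary: s)
  case (Suc M)
  then obtain x3 x2 x1 s' where s: "s = x3 # x2 # x1 # s'" "length s' = 3 * M"
    by (auto simp: Suc_length_conv length_Suc_conv eval_nat_numeral)
  have v: "valid G r s'" "x1 \<in> arcs G" "x2 \<in> arcs G" "x3 \<in> arcs G"
    "tail G x1 = cur G r s'" "tail G x2 = head G x1" "tail G x3 = head G x2"
    using Suc.prems(1) s by auto
  have c: "cur G r s' \<in> verts G" using cur_vert[OF v(1) root_vert] .
  have "int (lev (cur G r s')) = 3 * int M - 3 * int (length (nt G s'))"
    using lev_cur[OF v(1)] s(2) by simp
  then have "lev (cur G r s') = 0 \<and> length (nt G s') = M"
    using lev_le_2[OF c] by presburger
  then have r: "cur G r s' = r" and l: "length (nt G s') = M" using c lev_0_iff by auto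
  have x1: "x1 \<in> tree_arcs G"
    using lev_tail_nontree[of x1] nontree_iff[OF v(2)] v(5) r lev_root by auto
  have l1: "lev (head G x1) = 1" using lev_tree_arc[OF x1] v(5) r lev_root by simp
  have x2: "x2 \<in> tree_arcs G"
    using lev_tail_nontree[of x2] nontree_iff[OF v(3)] v(6) l1 by auto
  have nt: "nt G s = nt G (x3 # s')" using s x1 x2 by (simp add: nt_def)
  \<comment> \<open>With a tree arc on top only \<open>M\<close> nontree arcs would be left instead
    of \<open>Suc M\<close>.\<close>
  then have x3: "x3 \<notin> tree_arcs G"
    using Suc.prems(2) l by (auto simp: nt_def dest: arg_cong[where f = length])
  have "x3 = e" "nt G s' = replicate M e"
    using nt Suc.prems(2) x3 by (auto simp: nt_def)
  moreover have "x2 = f2"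
    using tree_arc_unique[OF f2 v(3)] head_f2 v(7) \<open>x3 = e\<close> by simp
  moreover have "x1 = f1"
    using tree_arc_unique[OF f1 v(2)] head_f1 v(6) \<open>x2 = f2\<close> by simp
  ultimately show ?case using Suc.IH[OF v(1) _ s(2)] s by (simp add: cyc_def)
qed (simp add: cyc_def nt_def)

text \<open>The last letter \<open>Neg e\<close> restricts where a period may start: no proper
  rotation of a loop is a loop for \<open>M = 1\<close>, and exactly one is for \<open>M = 2\<close>
  if the loop is not itself periodic.\<close>

definition loops :: "nat \<Rightarrow> nat \<Rightarrow> 'e symbol list set" where
  "loops M k = {w. length w = k \<and> w \<noteq> [] \<and> last w = Neg e \<and> runs G r w [] = Some (cyc M)}"

end

lemma append_swap_replicate:
  assumes "xs @ ys = replicate n x"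
  shows "ys @ xs = replicate n x"
proof (rule replicate_eqI)
  show "length (ys @ xs) = n" using arg_cong[OF assms, of length] by simp
  fix a assume "a \<in> set (ys @ xs)"
  then have "a \<in> set (replicate n x)" unfolding assms[symmetric] by auto
  then show "a = x" by (simp split: if_splits)
qed

context return_arc
begin

text \<open>
  Starting a period where the stack height is minimal makes the word run from the empty stack;
  rotating further to just after an unmatched \<open>Neg e\<close> makes it start at the root.
\<close>

lemma periodic_point_loop:
  assumes p: "p \<in> markov_dyck_shift G" and per: "(shift ^^ k) p = p" and k: "k > 0"
    and mult: "has_negative_multiplier G e p k"
  obtains j M where "M \<ge> 1" "wd p j k \<in> loops M k"
proof -
  have pk: "p (i + int k) = p i" for i using per by (simp add: shift_funpow_fixed_iff)
  have wk: "wd p (i + int k) n = wd p i n" for i n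
    using pk by (auto simp: wd_def algebra_simps) (metis add.assoc)
  have adm: "set (wd p i n) \<subseteq> symbols G \<and> (\<exists>b s t. runs G b (wd p i n) s = Some t)" if "n > 0" for i n
  proof -
    have "admissible G (map p [i..i + int n - 1])"
      using p that by (simp add: markov_dyck_shift_def)
    moreover have "wd p i n \<noteq> []" using that by (metis length_0_conv length_wd less_numeral_extra(3))
    ultimately show ?thesis using admissible_iff[of "wd p i n"] unfolding map_upto_wd by blast
  qed
  have letter: "p i \<in> symbols G" for i using adm[of 1 i] by (simp add: wd_def)
  have link: "tgt G (p i) = src G (p (i + 1))" for i
  proof -
    obtain b s t where "runs G b (wd p i 2) s = Some t" using adm[of 2 i] by auto
    moreover have "wd p i 2 = [p i, p (i + 1)]" by (simp add: wd_def upt_rec)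
    ultimately obtain s' where "act G b (Sym (p i)) s = Some s'" "act G b (Sym (p (i + 1))) s' = Some t"
      by (auto split: bind_splits)
    then show ?thesis using act_Sym by metis
  qed
  define H where "H i n = sum_list (map ht (wd p i n))" for i n
  define hH where "hH i n = sum_list (map (hht G) (wd p i n))" for i n
  have tele: "int (lev (src G (p (i + int n)))) - int (lev (src G (p i))) = H i n - 3 * hH i n" for i n
  proof (induction n)
    case (Suc n)
    have "src G (p (i + int (Suc n))) = tgt G (p (i + int n))"
      using link[of "i + int n"] by (simp add: algebra_simps)
    then show ?case using Suc lev_symbol[OF letter[of "i + int n"]] by (simp add: H_def hH_def wd_Suc)
  qed (simp add: H_def hH_def wd_def)

  obtain i M where M: "M \<ge> 1"
    and "gis_prod (bouquet (nontree_arcs G)) (map (\<lambda>j. hat G (p j)) [i..i + int k - 1]) =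
        gis_prod (bouquet (nontree_arcs G)) (replicate M (Sym (Neg e)))"
    using mult by (auto simp: has_negative_multiplier_def)
  moreover have "map (\<lambda>j. hat G (p j)) [i..i + int k - 1] = map (hat G) (wd p i k)"
    by (rule nth_equalityI) auto
  moreover have "wd p i k \<noteq> []" using k by (metis length_0_conv length_wd less_numeral_extra(3))
  ultimately have hr: "hruns G (wd p i k) [] = Some (replicate M e)"
    using negative_multiplier_iff[OF e, of "wd p i k" M] adm[OF k, of i] by simp
  have "hH i k = int M" using hruns_length[OF hr] by (simp add: hH_def)
  \<comment> \<open>The period starts and ends at the same vertex, so the potential does not
    change.\<close>
  then have Hk: "H i k = 3 * int M" using tele[of i k] pk[of i] by simp
  have Hadd: "H i (m + n) = H i m + H (i + int m) n" for i m n by (simp add: H_def wd_add)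
  have Hper: "H i (k + n) = H i n + 3 * int M" for n
    using Hadd[of i k n] Hk wk[of i n] by (simp add: H_def)
  obtain n0 where n0: "n0 < k" "\<And>n. n < k \<Longrightarrow> H i n0 \<le> H i n"
  proof -
    have "finite (H i ` {..<k})" "H i ` {..<k} \<noteq> {}" using k by auto
    from Min_in[OF this] Min_le[OF this(1)] show ?thesis using that by fastforce
  qed
  \<comment> \<open>Each further period adds \<open>3 * M\<close> to the height, so the minimum over
    one period is a minimum over all later positions.\<close>
  have min: "H i n0 \<le> H i n" for n
  proof (induction n rule: less_induct)
    case (less n)
    show ?case
    proof (cases "n < k")
      case False
      then have "H i n0 \<le> H i (n - k)" using less[of "n - k"] k by simp
      then show ?thesis using Hper[of "n - k"] False by simp
    qed (use n0 in auto)
  qed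
  define i0 where "i0 = i + int n0"
  define v where "v = src G (p i0)"
  define A where "A = wd p i n0"
  define B where "B = wd p i0 (k - n0)"
  have AB: "wd p i k = A @ B" using wd_add[of p i n0 "k - n0"] n0(1) by (simp add: A_def B_def i0_def)
  have BA: "wd p i0 k = B @ A"
    using wd_add[of p i0 "k - n0" n0] n0(1) wk[of i n0] by (simp add: A_def B_def i0_def)
  have take_wd: "take n (wd p i0 m) = wd p i0 n" if "n \<le> m" for n m
    by (rule nth_equalityI) (use that in auto)
  have nonneg: "sum_list (map ht (take n (wd p i0 m))) \<ge> 0" if "n \<le> m" for n m
    using take_wd[OF that] min[of "n0 + n"] Hadd[of i n0 n] by (simp add: H_def i0_def)
  obtain t where t: "runs G v (wd p i0 k) [] = Some t" "cur G v t = v"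
  proof -
    \<comment> \<open>The window has one letter more than a period: that letter equals the first one
      and shows that the period ends at its initial vertex \<open>v\<close>.\<close>
    obtain b s t where t: "runs G b (wd p i0 (Suc k)) s = Some t" using adm[of "Suc k" i0] by auto
    then obtain t0 where t0: "runs G b (wd p i0 k) s = Some t0" "act G b (Sym (p (i0 + int k))) t0 = Some t"
      by (auto simp: wd_Suc run_append split: bind_splits)
    have c0: "cur G b t0 = v" using act_Sym(1)[OF t0(2)] pk by (simp add: v_def)
    obtain k' where "k = Suc k'" using k by (cases k) auto
    then have "wd p i0 k = p i0 # wd p (i0 + 1) k'"
      using wd_add[of p i0 1 k'] by (simp add: wd_def)
    then obtain s' where "act G b (Sym (p i0)) s = Some s'"
      using t0(1) by (auto split: bind_splits)
    then have "cur G b s = v" using act_Sym(1) by (simp add: v_def)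
    moreover obtain t' where "runs G (cur G b s) (wd p i0 k) [] = Some t'" "t0 = t' @ s"
      using runs_nonneg[OF t0(1)] nonneg by auto
    ultimately show ?thesis using that c0 by (simp add: cur_append)
  qed
  obtain z' where z': "runs G v B [] = Some z'" using t(1) unfolding BA runs_append_Some by blast
  define z where "z = nt G z'"
  have z: "hruns G B [] = Some z" using hruns_nt[OF z'] by (simp add: z_def nt_def)
  obtain y where y: "hruns G A [] = Some y" "hruns G B y = Some (replicate M e)"
    using hr unfolding AB hruns_append by (auto split: bind_splits)
  \<comment> \<open>The rotated word yields \<open>y @ z\<close> instead; all entries being
    \<open>e\<close>, this is the same list.\<close>
  have zy: "z @ y = replicate M e" using hruns_lift[OF z, of y] y(2) by simp
  have "hruns G (wd p i0 k) [] = Some (y @ z)"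
    using hruns_lift[OF y(1), of z] z unfolding BA hruns_append by simp
  moreover have "hruns G (wd p i0 k) [] = Some (nt G t)" using hruns_nt[OF t(1)] by (simp add: nt_def)
  ultimately have ntt: "nt G t = replicate M e" using append_swap_replicate[OF zy] by simp
  have "e \<in> set (nt G t)" using ntt M by simp
  then have "e \<in> set t" by (simp add: nt_def)
  then obtain s2 s1 where s12: "t = s2 @ e # s1" by (auto simp: in_set_conv_decomp)
  from runs_split[of G v "wd p i0 k" s2 e s1] t(1) s12
  obtain x1 x2 where x: "wd p i0 k = x1 @ Neg e # x2" "runs G v x1 [] = Some s1"
    "runs G (head G e) x2 [] = Some s2" "e \<in> arcs G" "tail G e = cur G v s1" by auto
  define w where "w = x2 @ x1 @ [Neg e]"
  have x2: "runs G r x2 [] = Some s2" using x(3) head_nontree[OF e] by simp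
  have cs2: "cur G r s2 = v" using t(2) s12 head_nontree[OF e] by (cases s2) auto
  have "runs G r x1 s2 = Some (s1 @ s2)" using run_lift[of G r s2 "map Sym x1" "[]" s1] x(2) cs2 by simp
  moreover have "cur G r (s1 @ s2) = tail G e" using x(5) cs2 by (simp add: cur_append)
  ultimately have run: "runs G r w [] = Some (e # s1 @ s2)"
    using x2 x(4) by (simp add: w_def run_append)
  have val: "valid G r (e # s1 @ s2)" using runs_valid[OF run] by simp
  have "nt G s2 @ nt G (e # s1) = replicate M e" using ntt s12 by (simp add: nt_def)
  from append_swap_replicate[OF this] have n1: "nt G (e # s1 @ s2) = replicate M e"
    by (simp add: nt_def split: if_splits)
  have "length (s2 @ e # s1) = 3 * M"
    using runs_length[OF t(1)] s12 Hadd[of i n0 k] Hper[of n0] by (simp add: H_def i0_def add.commute)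
  then have "length (e # s1 @ s2) = 3 * M" by simp
  from valid_eq_cyc[OF val n1 this] run have run: "runs G r w [] = Some (cyc M)" by simp
  define l where "l = length (x1 @ [Neg e])"
  have lk: "l + length x2 = k" using arg_cong[OF x(1), of length] by (simp add: l_def)
  have "wd p i0 l = x1 @ [Neg e]" "wd p (i0 + int l) (length x2) = x2"
  proof -
    have eq: "(x1 @ [Neg e]) @ x2 = wd p i0 l @ wd p (i0 + int l) (length x2)"
      using wd_add[of p i0 l "length x2"] x(1) lk by simp
    have len: "length (x1 @ [Neg e]) = length (wd p i0 l)" by (simp add: l_def)
    note * = iffD1[OF append_eq_append_conv[OF disjI1[OF len]] eq]
    show "wd p i0 l = x1 @ [Neg e]" by (rule HOL.sym[OF conjunct1[OF *]])
    show "wd p (i0 + int l) (length x2) = x2" by (rule HOL.sym[OF conjunct2[OF *]])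
  qed
  moreover have "wd p (i0 + int l + int (length x2)) l = wd p i0 l"
    using wk[of i0 l] lk by (simp add: add.assoc flip: of_nat_add)
  moreover have "wd p (i0 + int l) k = wd p (i0 + int l) (length x2) @ wd p (i0 + int l + int (length x2)) l"
    using wd_add[of p "i0 + int l" "length x2" l] lk by (simp add: add.commute)
  ultimately have "wd p (i0 + int l) k = w" by (simp add: w_def)
  moreover have "w \<in> loops M k"
    using run lk by (simp add: loops_def w_def l_def)
  ultimately show ?thesis using that M by blast
qed

end

section \<open>Periodic orbits\<close>

definition per :: "'a list \<Rightarrow> int \<Rightarrow> 'a" where
  "per w i = w ! nat (i mod int (length w))"

lemma wd_per: "wd (per w) 0 (length w) = w"
  by (rule nth_equalityI) (auto simp: per_def)

lemma per_inject: "per w = per w' \<Longrightarrow> length w = length w' \<Longrightarrow> w = w'"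
  by (metis wd_per)

lemma per_period: "per w (i + int (length w)) = per w i"
  by (simp add: per_def)

lemma per_add:
  assumes "w \<noteq> []"
  shows "per w (i + int m) = per (rotate m w) i"
proof -
  let ?k = "int (length w)"
  have k: "?k > 0" using assms by simp
  have lt: "nat (i mod ?k) < length w" using k by (simp add: nat_less_iff)
  have "nat ((i + int m) mod ?k) = (m + nat (i mod ?k)) mod length w"
  proof -
    have "int ((m + nat (i mod ?k)) mod length w) = (i + int m) mod ?k"
      using k by (simp add: zmod_int mod_simps add.commute)
    then show ?thesis by (metis nat_int)
  qed
  then show ?thesis using lt by (simp add: per_def nth_rotate)
qed

lemma period_mult:
  fixes q :: int
  assumes "\<And>i. p (i + int k) = p i"
  shows "p (i + q * int k) = p i"
proof (induction q rule: int_induct[of _ 0])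
  case (step1 q)
  then show ?case using assms[of "i + q * int k"] by (simp add: algebra_simps)
next
  case (step2 q)
  then show ?case using assms[of "i + (q - 1) * int k"] by (simp add: algebra_simps)
qed simp

lemma period_mod:
  assumes "\<And>i. p (i + int k) = p i"
  shows "p (j + i mod int k) = p (j + i)"
proof -
  have "j + i mod int k + i div int k * int k = j + i" by (simp add: add.assoc)
  then show ?thesis using period_mult[of p k "j + i mod int k" "i div int k", OF assms] by metis
qed

lemma per_wd:
  assumes "\<And>i. p (i + int k) = p i" "k > 0"
  shows "per (wd p j k) i = p (i + j)"
  using period_mod[of p k j i, OF assms(1)] assms(2)
  by (simp add: per_def nat_less_iff add.commute)

lemma orbit_shift:
  assumes "\<And>i. p (i + int k) = p i" "k > 0"
  shows "orbit shift p = range (\<lambda>j i. p (i + j))"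
proof (intro equalityI subsetI)
  fix q assume "q \<in> range (\<lambda>j i. p (i + j))"
  then obtain j where q: "q = (\<lambda>i. p (i + j))" by auto
  \<comment> \<open>\<open>orbit\<close> consists of the positive iterates, so a full period is
    added to the residue.\<close>
  define n where "n = nat (j mod int k) + k"
  have "p (i + j) = p (i + int n)" for i
    using period_mod[of p k i j, OF assms(1)] assms(1)[of "i + j mod int k"] assms(2)
    by (simp add: n_def algebra_simps)
  then have "q = (shift ^^ n) p" by (simp add: q shift_funpow)
  moreover have "n > 0" using assms(2) by (simp add: n_def)
  ultimately show "q \<in> orbit shift p" by (auto simp: orbit_altdef)
qed (auto simp: orbit_altdef shift_funpow)

lemma orbit_shift_translate:
  assumes "\<And>i. p (i + int k) = p i" "k > 0"
  shows "orbit shift (\<lambda>i. p (i + j)) = orbit shift p"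
proof -
  have "range (\<lambda>l i. p (i + l + j)) = range (\<lambda>l i. p (i + l))"
  proof (intro equalityI subsetI)
    fix q assume "q \<in> range (\<lambda>l i. p (i + l))"
    then obtain l where "q = (\<lambda>i. p (i + l))" by auto
    then show "q \<in> range (\<lambda>l i. p (i + l + j))" by (intro range_eqI[of _ _ "l - j"]) simp
  next
    fix q assume "q \<in> range (\<lambda>l i. p (i + l + j))"
    then obtain l where "q = (\<lambda>i. p (i + l + j))" by auto
    then show "q \<in> range (\<lambda>l i. p (i + l))" by (intro range_eqI[of _ _ "l + j"]) (simp add: add.assoc)
  qed
  moreover have "p (i + int k + j) = p (i + j)" for i
    using assms(1)[of "i + j"] by (simp add: algebra_simps)
  ultimately show ?thesis
    using orbit_shift[of p k, OF assms] orbit_shift[of "\<lambda>i. p (i + j)" k] assms(2) by simp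
qed

lemma orbit_per_eqD:
  assumes "orbit shift (per w) = orbit shift (per w')" "length w = length w'" "w \<noteq> []"
  obtains m where "m < length w" "w' = rotate m w"
proof -
  have k: "length w > 0" "length w' > 0" using assms by auto
  have "per w' \<in> orbit shift (per w')"
    unfolding orbit_shift[of "per w'" "length w'", OF per_period k(2)]
    by (rule range_eqI[of _ _ 0]) simp
  then obtain j where j: "per w' = (\<lambda>i. per w (i + j))"
    unfolding assms(1)[symmetric] orbit_shift[of "per w" "length w", OF per_period k(1)] by auto
  define m where "m = nat (j mod int (length w))"
  have m: "m < length w" "int m = j mod int (length w)"
    using k by (auto simp: m_def nat_less_iff)
  have "per w' i = per (rotate m w) i" for i
    unfolding j per_add[OF assms(3), of i m, symmetric] m(2)
    by (rule period_mod[of "per w", OF per_period, symmetric])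
  then have "per w' = per (rotate m w)" by (rule ext)
  then have "w' = rotate m w" by (rule per_inject) (simp add: assms(2))
  then show ?thesis using that m(1) by blast
qed

lemma has_least_period_per:
  assumes "w \<noteq> []"
  shows "has_least_period (per w) (length w) \<longleftrightarrow> (\<forall>m. 0 < m \<and> m < length w \<longrightarrow> rotate m w \<noteq> w)"
proof -
  have "(shift ^^ m) (per w) = per (rotate m w)" for m
    using per_add[OF assms] by (auto simp: shift_funpow)
  moreover have "(shift ^^ length w) (per w) = per w"
    using per_period by (auto simp: shift_funpow)
  moreover have "per (rotate m w) = per w \<longleftrightarrow> rotate m w = w" for m
    using per_inject[of "rotate m w" w] by auto
  ultimately show ?thesis using assms by (simp add: has_least_period_def)
qed

lemma has_least_period_translate:
  assumes "has_least_period p k"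
  shows "has_least_period (\<lambda>i. p (i + j)) k"
proof -
  have "(shift ^^ m) (\<lambda>i. p (i + j)) = (\<lambda>i. p (i + j)) \<longleftrightarrow> (shift ^^ m) p = p" for m
    unfolding shift_funpow_fixed_iff
  proof
    assume *: "\<forall>i. p (i + int m + j) = p (i + j)"
    show "\<forall>i. p (i + int m) = p i"
    proof
      fix i show "p (i + int m) = p i" using *[rule_format, of "i - j"] by (simp add: algebra_simps)
    qed
  next
    assume *: "\<forall>i. p (i + int m) = p i"
    show "\<forall>i. p (i + int m + j) = p (i + j)"
    proof
      fix i show "p (i + int m + j) = p (i + j)" using *[rule_format, of "i + j"] by (simp add: algebra_simps)
    qed
  qed
  then show ?thesis using assms by (simp add: has_least_period_def)
qed

lemma runs_last_Neg:
  assumes "runs G b w [] = Some s" "w \<noteq> []" "last w = Neg f"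
  obtains s' where "s = f # s'" "tail G f = cur G b s'" "f \<in> arcs G"
proof -
  have "runs G b (butlast w @ [Neg f]) [] = Some s"
    using assms append_butlast_last_id[of w] by simp
  then show ?thesis
    using that unfolding runs_append_Some by (auto split: if_splits)
qed

section \<open>Loops as periodic points, and their rotations\<close>

context return_arc
begin

definition primitive_loops :: "nat \<Rightarrow> nat \<Rightarrow> 'e symbol list set" where
  "primitive_loops M k = {w \<in> loops M k. \<forall>m. 0 < m \<and> m < k \<longrightarrow> rotate m w \<noteq> w}"

text \<open>A loop starts and ends at the root, so each further copy runs above the stack left by
  the earlier ones.\<close>

lemma runs_periodic:
  assumes "w \<in> loops M k"
  shows "\<exists>s. cur G r s = r \<and> runs G r (wd (per w) 0 (N * k)) [] = Some s"
proof (induction N)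
  case (Suc N)
  then obtain s where s: "cur G r s = r" "runs G r (wd (per w) 0 (N * k)) [] = Some s" by auto
  have k: "length w = k" "runs G r w [] = Some (cyc M)" using assms by (auto simp: loops_def)
  have "wd (per w) (int (N * k)) k = w"
  proof (rule nth_equalityI)
    fix i assume "i < length (wd (per w) (int (N * k)) k)"
    then show "wd (per w) (int (N * k)) k ! i = w ! i"
      using k by (simp add: per_def)
  qed (use k in simp)
  then have "wd (per w) 0 (Suc N * k) = wd (per w) 0 (N * k) @ w"
    using wd_add[of "per w" 0 "N * k" k] by (simp add: add.commute)
  moreover have "runs G r w s = Some (cyc M @ s)"
    using run_lift[of G r s "map Sym w" "[]" "cyc M"] s(1) k by simp
  moreover have "cur G r (cyc M @ s) = r"
    using s(1) cur_cyc by (simp add: cur_append)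
  ultimately show ?case using s(2) by (auto simp: run_append)
qed (simp add: wd_def)

lemma loop_periodic_orbit:
  assumes w: "w \<in> primitive_loops M k" and M: "M \<ge> 1"
  shows "orbit shift (per w) \<in> periodic_orbits G e k"
proof -
  have wl: "w \<in> loops M k" using w by (simp add: primitive_loops_def)
  then have k: "length w = k" "w \<noteq> []" "k > 0" and rw: "runs G r w [] = Some (cyc M)"
    by (auto simp: loops_def)
  have "per w \<in> markov_dyck_shift G"
    unfolding markov_dyck_shift_def
  proof (intro CollectI allI impI)
    fix i j :: int assume ij: "i \<le> j"
    define n where "n = nat (j - i + 1)"
    define a where "a = nat (i mod int k)"
    have n: "n > 0" "j = i + int n - 1" using ij by (auto simp: n_def)
    have a: "int a = i mod int k" using k by (simp add: a_def)
    have "per w (i + int t) = per w (int a + int t)" for t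
      using period_mod[of "per w" "length w" "int t" i, OF per_period] k a by (simp add: add.commute)
    then have wa: "map (per w) [i..j] = wd (per w) (int a) n"
      unfolding n(2) map_upto_wd by (simp add: wd_def)
    \<comment> \<open>Moved by a multiple of the period, the window starts at a position
      \<open>a < k\<close> and lies within the first \<open>a + n\<close> copies of
      \<open>w\<close>.\<close>
    obtain s where s: "runs G r (wd (per w) 0 ((a + n) * k)) [] = Some s"
      using runs_periodic[OF wl] by blast
    have eq: "wd (per w) 0 ((a + n) * k) =
        wd (per w) 0 a @ wd (per w) (int a) n @ wd (per w) (int (a + n)) ((a + n) * k - (a + n))"
      using wd_add[of "per w" 0 "a + n" "(a + n) * k - (a + n)"] wd_add[of "per w" 0 a n] k(3) by simp
    from s[unfolded eq] obtain s1 s2 where s12: "runs G r (wd (per w) (int a) n) s1 = Some s2"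
      unfolding runs_append_Some by blast
    have "wd (per w) (int a) n \<noteq> []" using n(1) by (simp add: wd_def)
    from admissible_iff[OF this] show "admissible G (map (per w) [i..j])"
      unfolding wa using runs_symbols[OF s12] s12 by blast
  qed
  moreover have "has_least_period (per w) k"
    using has_least_period_per[OF k(2)] w k(1) by (simp add: primitive_loops_def)
  moreover have "has_negative_multiplier G e (per w) k"
    unfolding has_negative_multiplier_def
  proof (intro exI conjI)
    have "map (\<lambda>j. hat G (per w j)) [0..0 + int k - 1] = map (hat G) w"
      by (rule nth_equalityI) (use k in \<open>auto simp: per_def\<close>)
    moreover have "hruns G w [] = Some (replicate M e)"
      using hruns_nt[OF rw] by (simp add: nt_cyc) (simp add: nt_def)
    ultimately show "gis_prod (bouquet (nontree_arcs G)) (map (\<lambda>j. hat G (per w j)) [0..0 + int k - 1]) =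
        gis_prod (bouquet (nontree_arcs G)) (replicate M (Sym (Neg e)))"
      using negative_multiplier_iff[OF e k(2) runs_symbols[OF rw] M] by simp
  qed (rule M)
  ultimately show ?thesis by (auto simp: periodic_orbits_def)
qed

lemma periodic_orbit_loop:
  assumes "c \<in> periodic_orbits G e k"
  obtains M w where "M \<ge> 1" "w \<in> primitive_loops M k" "c = orbit shift (per w)"
proof -
  obtain p where p: "c = orbit shift p" "p \<in> markov_dyck_shift G" "has_least_period p k"
    "has_negative_multiplier G e p k"
    using assms by (auto simp: periodic_orbits_def)
  then have k: "k > 0" and sk: "(shift ^^ k) p = p" by (auto simp: has_least_period_def)
  then have pk: "p (i + int k) = p i" for i by (simp add: shift_funpow_fixed_iff)
  obtain j M where M: "M \<ge> 1" and w: "wd p j k \<in> loops M k"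
    using periodic_point_loop[OF p(2) sk k p(4)] by blast
  have per: "per (wd p j k) = (\<lambda>i. p (i + j))" using per_wd[of p k, OF pk k] by auto
  have "wd p j k \<noteq> []" using w by (simp add: loops_def)
  then have "wd p j k \<in> primitive_loops M k"
    using has_least_period_per[of "wd p j k"] has_least_period_translate[OF p(3), of j] per w
    by (simp add: primitive_loops_def)
  moreover have "c = orbit shift (per (wd p j k))"
    using orbit_shift_translate[of p k, OF pk k] p(1) per by simp
  ultimately show ?thesis using that M by blast
qed

text \<open>The net height is \<open>3 * M\<close> and every letter contributes 1 or -1, so the
  excess \<open>k - 3 * M\<close> is twice the number of pops.\<close>

lemma loops_length:
  assumes "w \<in> loops M k"
  shows "3 * M \<le> k" "even (k - 3 * M)"
proof -
  have l: "length w = k" and "runs G r w [] = Some (cyc M)" using assms by (auto simp: loops_def)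
  then have h: "sum_list (map ht w) = 3 * int M" using runs_length[of G r w "[]"] length_cyc by simp
  have "sum_list (map ht w) \<le> int (length w) \<and> even (int (length w) - sum_list (map ht w))" for w :: "'e symbol list"
  proof (induction w)
    case (Cons x w)
    then show ?case by (cases x) auto
  qed simp
  from this[of w] show "3 * M \<le> k" "even (k - 3 * M)" using h l by (auto simp: even_diff_nat)
qed

lemma periodic_orbits_eq:
  assumes "M \<ge> 1" "\<And>M'. M' \<ge> 1 \<Longrightarrow> 3 * M' \<le> k \<Longrightarrow> even (k - 3 * M') \<Longrightarrow> M' = M"
  shows "periodic_orbits G e k = (\<lambda>w. orbit shift (per w)) ` primitive_loops M k"
proof (intro equalityI subsetI)
  fix c assume "c \<in> periodic_orbits G e k"
  then obtain M' w where *: "M' \<ge> 1" "w \<in> primitive_loops M' k" "c = orbit shift (per w)"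
    by (rule periodic_orbit_loop)
  then have "M' = M" using assms(2) loops_length[of w M' k] by (auto simp: primitive_loops_def)
  then show "c \<in> (\<lambda>w. orbit shift (per w)) ` primitive_loops M k" using * by blast
qed (use loop_periodic_orbit assms(1) in blast)

text \<open>Both pieces end in \<open>Neg e\<close>, and both run from the empty stack, the second
  because the rotated word begins with it. Each leaves its own \<open>e\<close> on top.\<close>

lemma loops_rotate:
  assumes w: "w \<in> loops M k" and rot: "rotate m w \<in> loops M k" and m: "0 < m" "m < k"
  obtains s1 s2 where "runs G r (take m w) [] = Some (e # s1)" "last (take m w) = Neg e"
    "runs G r (drop m w) [] = Some (e # s2)" "(e # s2) @ e # s1 = cyc M"
proof -
  have k: "length w = k" "last w = Neg e" and rw: "runs G r w [] = Some (cyc M)"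
    using w by (auto simp: loops_def)
  have ne: "take m w \<noteq> []" "drop m w \<noteq> []" using m k by auto
  have r: "rotate m w = drop m w @ take m w" using m k by (simp add: rotate_drop_take)
  have lt: "last (take m w) = Neg e" using rot ne by (simp add: loops_def r)
  have ld: "last (drop m w) = Neg e" using k m by simp
  obtain s where s: "runs G r (take m w) [] = Some s" "runs G r (drop m w) s = Some (cyc M)"
    using rw append_take_drop_id[of m w] runs_append_Some by metis
  obtain s1 where s1: "s = e # s1" using runs_last_Neg[OF s(1) ne(1) lt] .
  have "runs G r (drop m w @ take m w) [] = Some (cyc M)" using rot by (simp add: loops_def r)
  then obtain s' where s': "runs G r (drop m w) [] = Some s'" unfolding runs_append_Some by blast
  obtain s2 where s2: "s' = e # s2" using runs_last_Neg[OF s' ne(2) ld] .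
  have "cur G r s = r" using s1 head_nontree[OF e] by simp
  then have "runs G r (drop m w) s = Some (s' @ s)"
    using run_lift[of G r s "map Sym (drop m w)" "[]" s'] s' by simp
  then have "(e # s2) @ e # s1 = cyc M" using s(2) s1 s2 by simp
  then show ?thesis using that s(1) s1 lt s' s2 by blast
qed

lemma cyc_simps: "cyc 1 = [e, f2, f1]" "cyc (Suc 0) = [e, f2, f1]" "cyc 2 = [e, f2, f1, e, f2, f1]"
  by (auto simp: cyc_def numeral_2_eq_2)

lemma cyc_add: "cyc (a + b) = cyc a @ cyc b"
  by (simp add: cyc_def replicate_add)

lemma loops_append:
  assumes "x \<in> loops a k" "y \<in> loops b l"
  shows "x @ y \<in> loops (a + b) (k + l)"
proof -
  have "runs G r y (cyc a) = Some (cyc b @ cyc a)"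
    using run_lift[of G r "cyc a" "map Sym y" "[]" "cyc b"] cur_cyc assms(2) by (simp add: loops_def)
  moreover have "cyc b @ cyc a = cyc (a + b)" using cyc_add[of b a] by (simp add: add.commute)
  ultimately show ?thesis using assms by (simp add: loops_def run_append)
qed

text \<open>The stack \<open>cyc 1\<close> contains \<open>e\<close> only once, too few for two
  pieces.\<close>

lemma loops_1_rotate:
  assumes "w \<in> loops 1 k" "0 < m" "m < k"
  shows "rotate m w \<notin> loops 1 k"
proof
  assume "rotate m w \<in> loops 1 k"
  from loops_rotate[OF assms(1) this assms(2,3)] obtain s1 s2 where "(e # s2) @ e # s1 = cyc 1" .
  then show False using e_neq by (auto simp: cyc_simps append_eq_Cons_conv)
qed

lemma loops_2_rotate:
  assumes "w \<in> loops 2 k" "rotate m w \<in> loops 2 k" "0 < m" "m < k"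
  shows "take m w \<in> loops 1 m" "drop m w \<in> loops 1 (k - m)"
proof -
  obtain s1 s2 where s: "runs G r (take m w) [] = Some (e # s1)" "last (take m w) = Neg e"
    "runs G r (drop m w) [] = Some (e # s2)" "(e # s2) @ e # s1 = cyc 2"
    using loops_rotate[OF assms] .
  have "s2 @ e # s1 = [f2, f1, e, f2, f1]" using s(4) cyc_simps by simp
  then have "s2 = [f2, f1] \<and> s1 = [f2, f1]"
    using e_neq by (auto simp: append_eq_Cons_conv)
  moreover have "length w = k" "last w = Neg e" using assms by (auto simp: loops_def)
  ultimately show "take m w \<in> loops 1 m" "drop m w \<in> loops 1 (k - m)"
    using s assms(3,4) by (auto simp: loops_def cyc_simps)
qed

text \<open>The cut comes right after the final push of the lower \<open>e\<close>. Both pieces then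
  run from the root to the root, so they can be exchanged.\<close>

lemma loops_2_split:
  assumes "w \<in> loops 2 k"
  obtains m where "0 < m" "m < k" "take m w \<in> loops 1 m" "drop m w \<in> loops 1 (k - m)"
proof -
  have k: "length w = k" "w \<noteq> []" "last w = Neg e" and rw: "runs G r w [] = Some ([e, f2, f1] @ e # [f2, f1])"
    using assms by (auto simp: loops_def cyc_simps)
  obtain x1 x2 where x: "w = x1 @ Neg e # x2" "runs G r x1 [] = Some [f2, f1]"
    "runs G (head G e) x2 [] = Some [e, f2, f1]" "e \<in> arcs G" "tail G e = cur G r [f2, f1]"
    using runs_split[OF rw] .
  define m where "m = Suc (length x1)"
  have tk: "take m w = x1 @ [Neg e]" "drop m w = x2" using x(1) by (auto simp: m_def)
  have "x2 \<noteq> []" using x(3) by auto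
  then have "0 < m" "m < k" "last x2 = Neg e" using k x(1) by (auto simp: m_def)
  moreover have "take m w \<in> loops 1 m"
    unfolding tk using x(2,4,5) by (simp add: loops_def run_append cyc_simps m_def)
  moreover have "drop m w \<in> loops 1 (k - m)"
    unfolding tk using x(1,3) k \<open>x2 \<noteq> []\<close> \<open>last x2 = Neg e\<close> head_nontree[OF e]
    by (auto simp: loops_def cyc_simps m_def)
  ultimately show ?thesis using that by blast
qed

text \<open>Between two cuts lies a word \<open>z\<close> that leads from \<open>cyc 1\<close> back
  to \<open>cyc 1\<close>. As the beginning of a loop it also runs from the empty stack, and ending
  in \<open>Neg e\<close> it leaves something there, so it would lengthen
  \<open>cyc 1\<close>.\<close>

lemma loops_2_split_unique:
  assumes "take m w \<in> loops 1 m" "drop m w \<in> loops 1 (k - m)" "take n w \<in> loops 1 n" "m < n"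
  shows False
proof -
  define z where "z = take (n - m) (drop m w)"
  have tn: "take n w = take m w @ z" using assms(4) by (simp add: z_def flip: take_add)
  have "length (take n w) = n" "length (take m w) = m" using assms(1,3) by (auto simp: loops_def)
  then have z: "z \<noteq> []" using tn assms(4) by auto
  then have lz: "last z = Neg e" using assms(3) by (simp add: loops_def tn)
  have "runs G r (z @ drop (n - m) (drop m w)) [] = Some (cyc 1)"
    using assms(2) by (simp add: loops_def z_def del: drop_drop)
  then obtain s where s: "runs G r z [] = Some s" unfolding runs_append_Some by blast
  obtain s' where "s = e # s'" using runs_last_Neg[OF s z lz] .
  moreover have "runs G r z (cyc 1) = Some (s @ cyc 1)"
    using run_lift[of G r "cyc 1" "map Sym z" "[]" s] s cur_cyc by simp
  moreover have "runs G r z (cyc 1) = Some (cyc 1)"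
    using assms(1,3) by (auto simp: loops_def tn run_append)
  ultimately show False by simp
qed

lemma loops_2_rotate_unique:
  assumes "w \<in> loops 2 k" "rotate m w \<in> loops 2 k" "0 < m" "m < k"
    and "rotate n w \<in> loops 2 k" "0 < n" "n < k"
  shows "m = n"
proof (rule linorder_cases)
  show "m = n" if "m < n"
    using loops_2_split_unique[OF loops_2_rotate[OF assms(1-4)]
        loops_2_rotate(1)[OF assms(1,5-7)] that] ..
  show "m = n" if "n < m"
    using loops_2_split_unique[OF loops_2_rotate[OF assms(1,5-7)]
        loops_2_rotate(1)[OF assms(1-4)] that] ..
qed

lemma finite_loops: "finite (loops M k)"
  by (rule finite_subset[OF _ finite_runs[of k r "cyc M"]]) (auto simp: loops_def)

lemma num_orbits_5: "num_orbits G e 5 = card (loops 1 5)"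
proof -
  have "periodic_orbits G e 5 = (\<lambda>w. orbit shift (per w)) ` primitive_loops 1 5"
  proof (rule periodic_orbits_eq)
    fix M' :: nat assume "1 \<le> M'" "3 * M' \<le> 5"
    then show "M' = 1" by simp
  qed simp
  moreover have prim: "primitive_loops 1 5 = loops 1 5"
  proof -
    have "rotate m w \<noteq> w" if "w \<in> loops 1 5" "0 < m \<and> m < 5" for m w
      using loops_1_rotate[OF that(1), of m] that by metis
    then have "\<forall>m. 0 < m \<and> m < 5 \<longrightarrow> rotate m w \<noteq> w" if "w \<in> loops 1 5" for w
      using that by simp
    then show ?thesis by (intro set_eqI iffI) (simp_all add: primitive_loops_def)
  qed
  moreover have "inj_on (\<lambda>w. orbit shift (per w)) (loops 1 5)"
  proof (rule inj_onI)
    fix w w' assume *: "w \<in> loops 1 5" "w' \<in> loops 1 5" "orbit shift (per w) = orbit shift (per w')"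
    have l: "length w = 5" "length w' = 5" "w \<noteq> []" using * by (auto simp: loops_def)
    obtain m where m: "m < length w" "w' = rotate m w"
      using orbit_per_eqD[OF *(3) _ l(3)] l(1,2) by metis
    have "m = 0" using loops_1_rotate[OF *(1), of m] *(2) l(1) m by (cases m) simp_all
    then show "w = w'" using m(2) by simp
  qed
  ultimately show ?thesis by (simp only: num_orbits_def card_image)
qed

text \<open>Exchanging the two pieces of a loop shows that each orbit of length 10 contains exactly
  two loops. The loops that are not primitive are the squares of the loops of length 5 and are
  counted apart.\<close>

lemma num_orbits_10: "2 * num_orbits G e 10 + card (loops 1 5) = card (loops 2 10)"
proof -
  let ?P = "primitive_loops 2 10"
  let ?F = "\<lambda>w. orbit shift (per w)"
  have po: "periodic_orbits G e 10 = ?F ` ?P"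
  proof (rule periodic_orbits_eq)
    fix M' :: nat assume *: "1 \<le> M'" "3 * M' \<le> 10" "even (10 - 3 * M')"
    then have "M' = 1 \<or> M' = 2 \<or> M' = 3" by auto
    then show "M' = 2" using *(3) by auto
  qed simp
  have finP: "finite ?P" by (rule finite_subset[OF _ finite_loops[of 2 10]]) (auto simp: primitive_loops_def)
  have fibre: "card {w' \<in> ?P. ?F w' = ?F w} = 2" if w: "w \<in> ?P" for w
  proof -
    have w2: "w \<in> loops 2 10" and prim: "\<And>m. 0 < m \<Longrightarrow> m < 10 \<Longrightarrow> rotate m w \<noteq> w"
      using w by (auto simp: primitive_loops_def)
    have l: "length w = 10" "w \<noteq> []" using w2 by (auto simp: loops_def)
    obtain m where m: "0 < m" "m < 10" "take m w \<in> loops 1 m" "drop m w \<in> loops 1 (10 - m)"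
      using loops_2_split[OF w2] .
    have rw: "rotate m w \<in> loops 2 10"
      using loops_append[OF m(4,3)] m l by (simp add: rotate_drop_take numeral_2_eq_2)
    have rp: "rotate m w \<in> ?P"
      unfolding primitive_loops_def
    proof (intro CollectI conjI allI impI rw notI)
      fix n assume n: "0 < n \<and> n < 10" "rotate n (rotate m w) = rotate m w"
      then have "rotate (10 - m) (rotate n (rotate m w)) = rotate (10 - m) (rotate m w)" by simp
      then have "rotate n (rotate 10 w) = rotate 10 w"
        using m by (simp add: rotate_rotate add.commute add.left_commute)
      then show False using prim n l by simp
    qed
    have "{w' \<in> ?P. ?F w' = ?F w} = {w, rotate m w}"
    proof (intro equalityI subsetI)
      fix w' assume w': "w' \<in> {w' \<in> ?P. ?F w' = ?F w}"
      then have w'2: "w' \<in> loops 2 10" by (simp add: primitive_loops_def)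
      then have "length w' = 10" by (simp add: loops_def)
      then obtain n where n: "n < 10" "w' = rotate n w" using orbit_per_eqD[of w w'] w' l by auto
      then show "w' \<in> {w, rotate m w}"
        using loops_2_rotate_unique[OF w2 rw m(1,2), of n] w'2 by (cases "n = 0") auto
    next
      fix w' assume "w' \<in> {w, rotate m w}"
      moreover have "?F (rotate m w) = ?F w"
      proof -
        have "per (rotate m w) = (\<lambda>i. per w (i + int m))" using per_add[OF l(2)] by auto
        then show ?thesis using orbit_shift_translate[of "per w" "length w", OF per_period] l by simp
      qed
      ultimately show "w' \<in> {w' \<in> ?P. ?F w' = ?F w}" using w rp by auto
    qed
    then show ?thesis using prim[OF m(1,2)] by simp
  qed
  have "card ?P = (\<Sum>c\<in>?F ` ?P. card {w' \<in> ?P. ?F w' = c})"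
    using sum.image_gen[OF finP, of "\<lambda>_. 1::nat" ?F] by simp
  also have "\<dots> = (\<Sum>c\<in>?F ` ?P. 2)" by (rule sum.cong) (use fibre in auto)
  finally have cP: "card ?P = 2 * num_orbits G e 10" by (simp add: num_orbits_def po)
  have np: "loops 2 10 - ?P = (\<lambda>x. x @ x) ` loops 1 5"
  proof (intro equalityI subsetI)
    fix w assume "w \<in> loops 2 10 - ?P"
    then obtain m where w: "w \<in> loops 2 10" and m: "0 < m" "m < 10" "rotate m w = w"
      by (auto simp: primitive_loops_def)
    have l: "length w = 10" using w by (simp add: loops_def)
    have "rotate (10 - m) w = rotate (10 - m) (rotate m w)" using m(3) by simp
    also have "\<dots> = w" using rotate_rotate[of "10 - m" m w] m(2) l by simp
    \<comment> \<open>Both rotations fix \<open>w\<close> and so yield loops, but only one proper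
      rotation can.\<close>
    finally have "m = 10 - m" using loops_2_rotate_unique[OF w _ m(1,2), of "10 - m"] m w by simp
    then have "m = 5" by simp
    then have t5: "take 5 w \<in> loops 1 5" and r5: "drop 5 w @ take 5 w = w"
      using loops_2_rotate(1)[OF w, of m] m w l by (auto simp: rotate_drop_take)
    have eq: "drop 5 w @ take 5 w = take 5 w @ drop 5 w" using r5 by simp
    have "length (drop 5 w) = length (take 5 w)" using l by simp
    from iffD1[OF append_eq_append_conv[OF disjI1[OF this]] eq]
    have "drop 5 w = take 5 w" by blast
    then show "w \<in> (\<lambda>x. x @ x) ` loops 1 5" using t5 r5 by (intro image_eqI[of _ _ "take 5 w"]) simp_all
  next
    fix w assume "w \<in> (\<lambda>x. x @ x) ` loops 1 5"
    then obtain x where x: "x \<in> loops 1 5" "w = x @ x" by auto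
    then have "w \<in> loops 2 10" using loops_append[OF x(1) x(1)] by (simp add: numeral_2_eq_2)
    moreover have "rotate 5 w = w" using rotate_append[of x x] x by (simp add: loops_def)
    ultimately show "w \<in> loops 2 10 - ?P" by (auto simp: primitive_loops_def intro!: exI[of _ 5])
  qed
  have "inj_on (\<lambda>x. x @ x) (loops 1 5)" by (rule inj_onI) (auto simp: loops_def)
  then have "card (loops 2 10 - ?P) = card (loops 1 5)" by (simp add: np card_image)
  moreover have "?P \<subseteq> loops 2 10" by (auto simp: primitive_loops_def)
  then have "card (loops 2 10) = card ?P + card (loops 2 10 - ?P)"
    using card_Diff_subset[OF finP] card_mono[OF finite_loops] by fastforce
  ultimately show ?thesis using cP by simp
qed

end

section \<open>Counting words\<close>

context height_two
begin

definition words :: "'e list \<Rightarrow> nat \<Rightarrow> 'e symbol list set" where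
  "words s n = {w. length w = n \<and> runs G r w [] = Some s}"

lemma finite_words: "finite (words s n)"
  unfolding words_def by (rule finite_runs)

lemma words_short: "n < length s \<Longrightarrow> words s n = {}"
proof -
  have "sum_list (map ht w) \<le> int (length w)" for w :: "'e symbol list"
  proof (induction w)
    case (Cons x w)
    then show ?case by (cases x) auto
  qed simp
  then have "int (length s) \<le> int (length w)" if "runs G r w [] = Some s" for w
    using runs_length[OF that] by simp
  then show "words s n = {}" if "n < length s" using that by (fastforce simp: words_def)
qed

text \<open>A word that builds \<open>s\<close> has one push per entry and a further push for every
  pop, so \<open>j\<close> is the number of pops.\<close>

definition count :: "nat \<Rightarrow> 'e list \<Rightarrow> nat" where
  "count j s = card (words s (length s + 2 * j))"

text \<open>The recursion removes the last letter, which either pushes the top arc or pops some arc.\<close>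

lemma card_words_Suc:
  assumes "valid G r s"
  shows "card (words s (Suc n)) = (case s of [] \<Rightarrow> 0 | a # s' \<Rightarrow> card (words s' n)) +
    (\<Sum>f\<in>out_arcs G (cur G r s). card (words (f # s) n))"
proof -
  define A where "A = (case s of [] \<Rightarrow> {} | a # s' \<Rightarrow> (\<lambda>w. w @ [Neg a]) ` words s' n)"
  define B where "B f = (\<lambda>w. w @ [Pos f]) ` words (f # s) n" for f
  have "words s (Suc n) = A \<union> (\<Union>f\<in>out_arcs G (cur G r s). B f)"
  proof (intro equalityI subsetI)
    fix w assume "w \<in> words s (Suc n)"
    then have l: "length w = Suc n" and rn: "runs G r w [] = Some s" by (auto simp: words_def)
    obtain w' x where w: "w = w' @ [x]" using l by (cases w rule: rev_cases) auto
    with rn obtain s0 where s0: "runs G r w' [] = Some s0" "act G r (Sym x) s0 = Some s"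
      by (auto simp: run_append split: bind_splits)
    show "w \<in> A \<union> (\<Union>f\<in>out_arcs G (cur G r s). B f)"
    proof (cases x)
      case (Neg f)
      then have "s = f # s0" using s0(2) by (auto split: if_splits)
      then show ?thesis using s0(1) l w Neg by (simp add: A_def words_def)
    next
      case (Pos f)
      then have "s0 = f # s" "f \<in> out_arcs G (cur G r s)"
        using s0(2) by (cases s0; auto split: if_splits)+
      moreover have "w \<in> B f" using calculation s0(1) l w Pos by (simp add: B_def words_def)
      ultimately show ?thesis by blast
    qed
  next
    fix w assume "w \<in> A \<union> (\<Union>f\<in>out_arcs G (cur G r s). B f)"
    then show "w \<in> words s (Suc n)"
    proof
      assume "w \<in> A"
      then show ?thesis
        using assms by (cases s) (auto simp: A_def words_def run_append)
    qed (auto simp: B_def words_def run_append)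
  qed
  moreover have "finite A" unfolding A_def by (cases s) (simp_all add: finite_words)
  moreover have "finite (\<Union>f\<in>out_arcs G (cur G r s). B f)"
    by (rule finite_UN_I[OF finite_out_arcs]) (simp add: B_def finite_words)
  moreover have "A \<inter> (\<Union>f\<in>out_arcs G (cur G r s). B f) = {}"
    by (cases s) (auto simp: A_def B_def)
  moreover have "card A = (case s of [] \<Rightarrow> 0 | a # s' \<Rightarrow> card (words s' n))"
    by (cases s) (auto simp: A_def card_image inj_on_def)
  moreover have "card (\<Union>f\<in>out_arcs G (cur G r s). B f) = (\<Sum>f\<in>out_arcs G (cur G r s). card (words (f # s) n))"
  proof -
    have "card (\<Union>f\<in>out_arcs G (cur G r s). B f) = (\<Sum>f\<in>out_arcs G (cur G r s). card (B f))"
      by (rule card_UN_disjoint) (auto simp: B_def finite_words)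
    moreover have "card (B f) = card (words (f # s) n)" for f
      by (auto simp: B_def card_image inj_on_def)
    ultimately show ?thesis by simp
  qed
  ultimately show ?thesis
    using card_Un_disjoint[of A "\<Union>f\<in>out_arcs G (cur G r s). B f"] by simp
qed

lemma count_0:
  assumes "valid G r s"
  shows "count 0 s = 1"
  using assms
proof (induction s)
  case Nil
  have "words [] 0 = {[]}" by (auto simp: words_def)
  then show ?case by (simp add: count_def)
next
  case (Cons a s)
  then show ?case
    using card_words_Suc[OF Cons.prems, of "length s"] by (simp add: count_def words_short)
qed

lemma count_Suc_Nil: "count (Suc j) [] = (\<Sum>f\<in>out_arcs G r. count j [f])"
  using card_words_Suc[of "[]" "Suc (2 * j)"] by (simp add: count_def)

lemma count_Suc_Cons:
  assumes "valid G r (a # s)"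
  shows "count (Suc j) (a # s) = count (Suc j) s + (\<Sum>f\<in>out_arcs G (head G a). count j (f # a # s))"
  using card_words_Suc[OF assms, of "length s + 2 * Suc j"] by (simp add: count_def)

abbreviation deg :: "'v \<Rightarrow> nat" where
  "deg \<equiv> out_degree G"

lemma sum_out_arcs_const: "(\<Sum>f\<in>out_arcs G v. k) = deg v * (k :: nat)"
  by (simp add: out_degree_def)

lemma valid_out_arc: "valid G r s \<Longrightarrow> f \<in> out_arcs G (cur G r s) \<Longrightarrow> valid G r (f # s)"
  by simp

lemma count_1_Nil: "count 1 [] = deg r"
proof -
  have "(\<Sum>f\<in>out_arcs G r. count 0 [f]) = (\<Sum>f\<in>out_arcs G r. 1)"
    by (rule sum.cong) (use count_0 valid_out_arc[of "[]"] in auto)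
  then show ?thesis using count_Suc_Nil[of 0] by (simp add: out_degree_def)
qed

text \<open>A final pop undoes the push of an arc out of the end vertex, and the letters before it
  are forced, as no pop is left.\<close>

lemma count_1_Cons:
  assumes "valid G r (a # s)"
  shows "count 1 (a # s) = count 1 s + deg (head G a)"
proof -
  have "(\<Sum>f\<in>out_arcs G (head G a). count 0 (f # a # s)) = (\<Sum>f\<in>out_arcs G (head G a). 1)"
    by (rule sum.cong) (use count_0 valid_out_arc[OF assms] in auto)
  then show ?thesis using count_Suc_Cons[OF assms, of 0] by (simp add: out_degree_def)
qed

text \<open>The number of walks of length two from \<open>v\<close>; with two pops, an excursion may
  go two arcs away from the stack.\<close>

definition deg2 :: "'v \<Rightarrow> nat" where
  "deg2 v = (\<Sum>f\<in>out_arcs G v. deg (head G f))"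

lemma sum_count_1:
  assumes "valid G r s"
  shows "(\<Sum>f\<in>out_arcs G (cur G r s). count 1 (f # s)) = deg (cur G r s) * count 1 s + deg2 (cur G r s)"
proof -
  have "(\<Sum>f\<in>out_arcs G (cur G r s). count 1 (f # s)) =
      (\<Sum>f\<in>out_arcs G (cur G r s). count 1 s + deg (head G f))"
    by (rule sum.cong) (use count_1_Cons valid_out_arc[OF assms] in blast)+
  then show ?thesis by (simp only: sum.distrib sum_out_arcs_const deg2_def)
qed

lemma count_2_Nil: "count 2 [] = deg r * count 1 [] + deg2 r"
  using count_Suc_Nil[of 1] sum_count_1[of "[]"] by (simp add: numeral_2_eq_2)

lemma count_2_Cons:
  assumes "valid G r (a # s)"
  shows "count 2 (a # s) = count 2 s + deg (head G a) * count 1 (a # s) + deg2 (head G a)"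
  using count_Suc_Cons[OF assms, of 1] sum_count_1[OF assms] by (simp add: numeral_2_eq_2)

end

context return_arc
begin

text \<open>The last letter of a loop pushes the top entry \<open>e\<close>; deleting it is a
  bijection that keeps the number of pops.\<close>

lemma card_loops_Suc:
  assumes "cyc M = e # s" "3 * M + 2 * j = k" "M > 0"
  shows "card (loops M k) = count j s"
proof -
  obtain k' where k': "k = Suc k'" using assms(2,3) by (cases k) auto
  have ls: "length s + 2 * j = k'" using arg_cong[OF assms(1), of length] assms(2) k' length_cyc by simp
  have v: "valid G r (e # s)" using valid_cyc[of M] assms(1) by simp
  have "loops M k = (\<lambda>w. w @ [Neg e]) ` words s k'"
  proof (intro equalityI subsetI)
    fix w assume w: "w \<in> loops M k"
    then have "w = butlast w @ [Neg e]" "runs G r w [] = Some (e # s)" "length w = Suc k'"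
      using append_butlast_last_id[of w] assms(1) k' by (auto simp: loops_def)
    then obtain w' where w': "w = w' @ [Neg e]" "runs G r w [] = Some (e # s)" "length w' = k'"
      by (metis length_append_singleton nat.inject)
    then have "runs G r w' [] = Some s"
      by (auto simp: run_append split: bind_splits if_splits)
    then show "w \<in> (\<lambda>w. w @ [Neg e]) ` words s k'" using w' by (auto simp: words_def)
  qed (use v assms(1) k' in \<open>auto simp: words_def loops_def run_append\<close>)
  then show ?thesis using ls by (simp add: card_image inj_on_def count_def)
qed

abbreviation "mid \<equiv> tail G f2"
abbreviation "leaf \<equiv> tail G e"

lemma valid_stacks:
  "valid G r [f1]" "valid G r [f2, f1]" "valid G r [e, f2, f1]" "valid G r [f1, e, f2, f1]"
  "valid G r [f2, f1, e, f2, f1]"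
  using valid_cyc[of 2] head_nontree[OF e] by (simp_all add: cyc_simps)

text \<open>With a single pop, the pushes of \<open>f1\<close>, \<open>f2\<close>, \<open>e\<close>
  are interrupted by one excursion along an arc and back, at the root, at \<open>mid\<close> or at
  \<open>leaf\<close>.\<close>

lemma num_orbits_5_eq: "num_orbits G e 5 = deg r + deg mid + deg leaf"
proof -
  have "card (loops 1 5) = count 1 [f2, f1]"
    by (rule card_loops_Suc) (simp_all add: cyc_simps)
  also have "\<dots> = deg r + deg mid + deg leaf"
    using count_1_Cons[OF valid_stacks(2)] count_1_Cons[OF valid_stacks(1)] count_1_Nil
      head_f1 head_f2 by simp
  finally show ?thesis using num_orbits_5 by simp
qed

text \<open>The recursion is unrolled along the six stacks below the final push of \<open>e\<close>.
  Each contributes the out-degree of its end vertex times \<open>count 1\<close>, and a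
  \<open>deg2\<close>; the end vertices are the root, \<open>mid\<close> and \<open>leaf\<close>
  twice each, whence the factor 2.\<close>

lemma num_orbits_10_eq:
  fixes A n m :: nat
  defines "A \<equiv> deg r" and "n \<equiv> deg mid" and "m \<equiv> deg leaf"
  shows "2 * num_orbits G e 10 + (A + n + m) =
    A * A + n * (A + n) + m * (A + n + m) + A * (2 * A + n + m) + n * (2 * A + 2 * n + m)
      + m * (2 * A + 2 * n + 2 * m) + 2 * (deg2 r + deg2 mid + deg2 leaf)"
proof -
  have h: "head G f1 = mid" "head G f2 = leaf" "head G e = r"
    using head_f1 head_f2 head_nontree[OF e] by simp_all
  note v = valid_stacks
  have c1: "count 1 [] = A" "count 1 [f1] = A + n" "count 1 [f2, f1] = A + n + m"
    "count 1 [e, f2, f1] = 2 * A + n + m" "count 1 [f1, e, f2, f1] = 2 * A + 2 * n + m"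
    "count 1 [f2, f1, e, f2, f1] = 2 * A + 2 * n + 2 * m"
    using count_1_Nil count_1_Cons[OF v(1)] count_1_Cons[OF v(2)] count_1_Cons[OF v(3)]
      count_1_Cons[OF v(4)] count_1_Cons[OF v(5)] h by (simp_all add: A_def n_def m_def)
  have "card (loops 2 10) = count 2 [f2, f1, e, f2, f1]"
    by (rule card_loops_Suc) (simp_all add: cyc_simps)
  also have "\<dots> = A * A + n * (A + n) + m * (A + n + m) + A * (2 * A + n + m) + n * (2 * A + 2 * n + m)
      + m * (2 * A + 2 * n + 2 * m) + 2 * (deg2 r + deg2 mid + deg2 leaf)"
    unfolding count_2_Cons[OF v(5)] count_2_Cons[OF v(4)] count_2_Cons[OF v(3)]
      count_2_Cons[OF v(2)] count_2_Cons[OF v(1)] count_2_Nil c1 h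
    by (simp add: A_def n_def m_def)
  finally show ?thesis
    using num_orbits_10 num_orbits_5 num_orbits_5_eq by (simp add: A_def n_def m_def)
qed

end

section \<open>Spherical homogeneity\<close>

context height_two
begin

lemma level_pred:
  assumes "v \<in> verts G" "lev v = Suc n"
  obtains f where "f \<in> tree_arcs G" "head G f = v" "lev (tail G f) = n"
proof -
  obtain q where q: "T.awalk r q v" using tree_walk[OF assms(1)] .
  then have "q \<noteq> []" using lev_walk[OF q] assms(2) by auto
  then obtain q' f where "q = q' @ [f]" by (cases q rule: rev_cases) auto
  with q have f: "f \<in> tree_arcs G" "head G f = v" by (auto simp: T.awalk_simps)
  then show ?thesis using that lev_tree_arc[OF f(1)] assms(2) by simp
qed

text \<open>Nontree arcs start at level two and all leaves lie there. So on lower levels the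
  out-degrees in \<open>G\<close> and in the subtree agree and are positive.\<close>

lemma out_arcs_level_lt_2:
  assumes "v \<in> verts G" "lev v < 2"
  shows "out_arcs G v \<subseteq> tree_arcs G" "out_arcs G v \<noteq> {}" "out_arcs (subtree G) v = out_arcs G v"
proof -
  show sub: "out_arcs G v \<subseteq> tree_arcs G"
  proof
    fix f assume f: "f \<in> out_arcs G v"
    then show "f \<in> tree_arcs G" using lev_tail_nontree[of f] nontree_iff[of f] assms(2) by auto
  qed
  then show "out_arcs (subtree G) v = out_arcs G v"
    using tree_arcs_subset by (auto simp: out_arcs_def)
  have "v \<notin> leaves (subtree G)" using lev_leaf[of v] assms(2) by auto
  then obtain f where "f \<in> tree_arcs G" "tail G f = v" using leaves_iff assms(1) by blast
  then have "f \<in> out_arcs G v" using tree_arcsD by simp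
  then show "out_arcs G v \<noteq> {}" by blast
qed

text \<open>By strong connectedness a walk leads back to the root; its first arc leaves the leaf and
  so cannot be a tree arc.\<close>

lemma leaf_out_arc:
  assumes "v \<in> verts G" "lev v = 2"
  obtains e where "e \<in> nontree_arcs G" "tail G e = v"
proof -
  have "v \<rightarrow>\<^sup>* r" using connected root_vert assms(1) by (auto simp: strongly_connected_def)
  moreover have "v \<noteq> r" using lev_root assms(2) by auto
  moreover obtain q where "awalk v q r" using calculation(1) by (auto simp: reachable_awalk)
  ultimately have q: "awalk v q r" "q \<noteq> []" by (auto simp: awalk_Nil_iff)
  then obtain e where "e \<in> arcs G" "tail G e = v" by (cases q) (auto simp: awalk_Cons_iff)
  moreover have "e \<notin> tree_arcs G"
    using calculation assms leaves_iff leaves_iff_lev by blast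
  ultimately show ?thesis using that nontree_iff by blast
qed

text \<open>This makes the out-degrees of every leaf and of its parent visible to the orbit numbers
  of some nontree arc.\<close>

lemma leaf_return_arc:
  assumes "v \<in> verts G" "lev v = 2"
  obtains e f1 f2 where "return_arc G r e f1 f2" "tail G e = v"
proof -
  obtain e where e: "e \<in> nontree_arcs G" "tail G e = v" using leaf_out_arc[OF assms] .
  obtain f2 where f2: "f2 \<in> tree_arcs G" "head G f2 = v" "lev (tail G f2) = Suc 0"
    using level_pred[OF assms(1), of 1] assms(2) by auto
  obtain f1 where f1: "f1 \<in> tree_arcs G" "head G f1 = tail G f2" "lev (tail G f1) = 0"
    using level_pred[OF _ f2(3)] tree_arcsD[OF f2(1)] by auto
  have "tail G f1 = r" using lev_0_iff f1(3) tree_arcsD[OF f1(1)] by simp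
  then have "return_arc G r e f1 f2" using e f1 f2 by unfold_locales auto
  then show ?thesis using that e(2) by blast
qed

lemma spherically_homogeneousI:
  assumes "\<And>k e e'. k \<in> {5, 10} \<Longrightarrow> e \<in> nontree_arcs G \<Longrightarrow> e' \<in> nontree_arcs G \<Longrightarrow>
    num_orbits G e k = num_orbits G e' k"
  shows "spherically_homogeneous G r"
proof -
  have leaf_eq: "deg v = deg v' \<and> deg (tail G f) = deg (tail G f')"
    if v: "v \<in> verts G" "lev v = 2" "f \<in> tree_arcs G" "head G f = v"
      and v': "v' \<in> verts G" "lev v' = 2" "f' \<in> tree_arcs G" "head G f' = v'" for v v' f f'
  proof -
    \<comment> \<open>Period 5 alone: the root term is common, so the sum over a leaf and its parent
      is constant.\<close>
    have const: "deg (tail G f) + deg v = deg (tail G g) + deg u"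
      if v: "v \<in> verts G" "lev v = 2" "f \<in> tree_arcs G" "head G f = v"
        and u: "u \<in> verts G" "lev u = 2" "g \<in> tree_arcs G" "head G g = u" for u g v f
    proof -
      obtain e f1 f2 where 1: "return_arc G r e f1 f2" "tail G e = v" using leaf_return_arc[OF v(1,2)] .
      obtain e' f1' f2' where 2: "return_arc G r e' f1' f2'" "tail G e' = u"
        using leaf_return_arc[OF u(1,2)] .
      interpret a: return_arc G r e f1 f2 by (rule 1)
      interpret b: return_arc G r e' f1' f2' by (rule 2)
      have "f2 = f" "f2' = g"
        using tree_arc_unique[OF v(3), of f2] tree_arc_unique[OF u(3), of f2'] v u 1 2
          a.head_f2 b.head_f2 a.arcs_e b.arcs_e by auto
      then show ?thesis
        using a.num_orbits_5_eq b.num_orbits_5_eq assms[of 5, OF _ a.e b.e] 1(2) 2(2)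
        by simp
    qed
    define c where "c = deg (tail G f) + deg v"
    \<comment> \<open>With n + m = c the quadratic terms become 3 A A + 4 A c + 3 c c - 2 n m.
      Adding 2 \<open>deg2 mid\<close> = 2 n m and 2 \<open>deg2 leaf\<close> = 2 A m leaves A m as
      the only quantity that depends on the leaf.\<close>
    have ten: "\<exists>e. e \<in> nontree_arcs G \<and> 2 * num_orbits G e 10 + (deg r + c) =
        3 * deg r * deg r + 4 * deg r * c + 3 * c * c + 2 * deg2 r + 2 * (deg r * deg u)"
      if u: "u \<in> verts G" "lev u = 2" "g \<in> tree_arcs G" "head G g = u" for u g
    proof -
      obtain e f1 f2 where 1: "return_arc G r e f1 f2" "tail G e = u" using leaf_return_arc[OF u(1,2)] .
      interpret a: return_arc G r e f1 f2 by (rule 1)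
      have g: "f2 = g" using tree_arc_unique[OF u(3), of f2] u 1 a.head_f2 a.arcs_e by auto
      have sum: "deg a.mid + deg a.leaf = c"
        using const[OF u v] g 1(2) by (simp add: c_def)
      have lm: "lev a.mid = 1" using lev_tree_arc[OF a.f2] a.head_f2 1(2) u(2) by simp
      have vm: "a.mid \<in> verts G" using tree_arcsD[OF a.f2] by simp
      \<comment> \<open>The children of \<open>mid\<close> are leaves with a common parent, so the
        constant sum gives them equal out-degrees.\<close>
      have "deg (head G h) = deg a.leaf" if h: "h \<in> out_arcs G a.mid" for h
      proof -
        have ht: "h \<in> tree_arcs G" "tail G h = a.mid" using h out_arcs_level_lt_2(1)[OF vm] lm by auto
        have "deg (tail G h) + deg (head G h) = c"
          using const[OF _ _ ht(1) HOL.refl v] tree_arcsD[OF ht(1)] lev_tree_arc[OF ht(1)] ht(2) lm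
          by (simp add: c_def)
        then show ?thesis using sum ht(2) by simp
      qed
      then have d_mid: "deg2 a.mid = deg a.mid * deg a.leaf"
        unfolding deg2_def using sum_out_arcs_const[where v = a.mid and k = "deg a.leaf"] by simp
      have "head G h = r" if h: "h \<in> out_arcs G a.leaf" for h
      proof -
        have "h \<notin> tree_arcs G"
          using h leaves_iff leaves_iff_lev u(1,2) 1(2) by auto
        then show ?thesis using h head_nontree nontree_iff by auto
      qed
      then have d_leaf: "deg2 a.leaf = deg a.leaf * deg r"
        unfolding deg2_def using sum_out_arcs_const[where v = a.leaf and k = "deg r"] by simp
      have "deg a.leaf = deg u" using 1(2) by simp
      then show ?thesis
        using a.num_orbits_10_eq a.e unfolding d_mid d_leaf sum[symmetric]
        by (intro exI[of _ e]) (simp add: algebra_simps)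
    qed
    obtain e where e: "e \<in> nontree_arcs G" "2 * num_orbits G e 10 + (deg r + c) =
        3 * deg r * deg r + 4 * deg r * c + 3 * c * c + 2 * deg2 r + 2 * (deg r * deg v)"
      using ten[OF v] by blast
    obtain e' where e': "e' \<in> nontree_arcs G" "2 * num_orbits G e' 10 + (deg r + c) =
        3 * deg r * deg r + 4 * deg r * c + 3 * c * c + 2 * deg2 r + 2 * (deg r * deg v')"
      using ten[OF v'] by blast
    have "deg r * deg v = deg r * deg v'"
      using e(2) e'(2) assms[of 10, OF _ e(1) e'(1)] by auto
    moreover have "deg r > 0"
      using out_arcs_level_lt_2(2)[OF root_vert] lev_root
      by (simp add: out_degree_def card_gt_0_iff finite_out_arcs)
    ultimately have "deg v = deg v'" by simp
    then show ?thesis using const[OF v v'] by simp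
  qed
  have lf: "u \<in> leaves (subtree G) \<Longrightarrow> \<exists>f. u \<in> verts G \<and> lev u = 2 \<and> f \<in> tree_arcs G \<and> head G f = u" for u
    using level_pred[of u 1] leaves_iff_lev by (metis Suc_1)
  show ?thesis
    unfolding spherically_homogeneous_def
  proof (intro conjI ballI impI)
    fix u v assume "u \<in> leaves (subtree G)" "v \<in> leaves (subtree G)"
    then show "lev u = lev v" by (simp add: lev_leaf)
  next
    fix e assume "e \<in> nontree_arcs G"
    then show "tail G e \<in> leaves (subtree G)"
      using leaves_iff_lev lev_tail_nontree by (auto simp: nontree_arcs_def)
  next
    fix u v assume "u \<in> leaves (subtree G)" "v \<in> leaves (subtree G)"
    then show "deg u = deg v" using lf leaf_eq by metis
  next
    fix u v assume uv: "u \<in> verts G" "v \<in> verts G" "lev u = lev v"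
    consider "lev u = 0" | "lev u = 1" | "lev u = 2" using lev_le_2[OF uv(1)] by linarith
    then show "out_degree (subtree G) u = out_degree (subtree G) v"
    proof cases
      case 1
      then show ?thesis using uv lev_0_iff by metis
    next
      case 2
      \<comment> \<open>A level-one vertex is the parent of some leaf, so \<open>leaf_eq\<close>
        compares its out-degree too.\<close>
      have child: "\<exists>f. f \<in> tree_arcs G \<and> tail G f = x \<and> head G f \<in> verts G \<and> lev (head G f) = 2"
        if x: "x \<in> verts G" "lev x = 1" for x
      proof -
        have "out_arcs G x \<subseteq> tree_arcs G" "out_arcs G x \<noteq> {}"
          using out_arcs_level_lt_2(1,2)[OF x(1)] x(2) by simp_all
        then obtain f where "f \<in> tree_arcs G" "f \<in> out_arcs G x" by blast
        then have "f \<in> tree_arcs G" "tail G f = x" by simp_all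
        then show ?thesis using tree_arcsD[of f] lev_tree_arc[of f] x(2) by auto
      qed
      obtain f g where "f \<in> tree_arcs G" "tail G f = u" "head G f \<in> verts G" "lev (head G f) = 2"
        "g \<in> tree_arcs G" "tail G g = v" "head G g \<in> verts G" "lev (head G g) = 2"
        using child[of u] child[of v] uv 2 by auto
      then have "deg u = deg v" using leaf_eq by blast
      then show ?thesis using out_arcs_level_lt_2(3) uv 2 by (simp add: out_degree_def)
    next
      case 3
      then have "u \<in> leaves (subtree G)" "v \<in> leaves (subtree G)"
        using uv leaves_iff_lev by auto
      then show ?thesis by (simp add: leaves_def)
    qed
  qed
qed

end

theorem theorem5p6:
  fixes G :: "('v, 'e) pre_digraph" and r :: 'v
  assumes "fin_digraph G"
    and "strongly_connected G"
    and "\<not> is_cycle_graph G"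
    and "directed_tree (subtree G) r"
    and "uniform_height G r 2"
    and "\<And>k e e'. k \<in> {5, 9, 10} \<Longrightarrow> e \<in> nontree_arcs G \<Longrightarrow> e' \<in> nontree_arcs G \<Longrightarrow>
           num_orbits G e k = num_orbits G e' k"
  shows "spherically_homogeneous G r"
proof -
  interpret height_two G r
    using assms(1,2,4,5) by (simp add: height_two_def height_two_axioms_def)
  show ?thesis using assms(6) by (intro spherically_homogeneousI) auto
qed

end
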